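(* For every constant $c>0$ there is a constant $C>0$ such that the following holds in the spherical Gaussian mixture setting described in the context. Suppose $\sigma\le c\,\Delta_{\min}/\sqrt k$. Let $P$ denote the $m\times N$ matrix whose $(a,i)$th column is $x_{a,i}$, and let $c_{a,i}$ denote the $(a,i)$th column of $PX_D$. Then $$\frac1N\sum_{a=1}^k\sum_{i=1}^n\|c_{a,i}-\tilde\gamma_a\|_2^2\le C\,\frac{\|\Gamma\|_{2\to2}^2}{\Delta_{\min}^2}\cdot k\sigma^2$$ with high probability as $n\to\infty$ (i.e. with probability tending to $1$ as $n\to\infty$, all other parameters being fixed). Here $\Gamma$ is the $m\times k$ matrix whose $a$th column is $\tilde\gamma_a-\frac1k\sum_{b=1}^k\tilde\gamma_b$.
   Context: Setting. Let $k\ge2$, $m\ge1$, $\sigma>0$, and let $\gamma_1,\dots,\gamma_k\in\mathbb R^m$ be distinct. For each $a\in\{1,\dots,k\}$, $n$ points $x_{a,1},\dots,x_{a,n}$ are drawn from $\mathcal N(\gamma_a,\sigma^2I_m)$, all points independent; $N=kn$. $\Delta_{\min}=\min_{a\neq b}\|\gamma_a-\gamma_b\|_2$. $\tilde\gamma_a:=\frac1n\sum_{i=1}^n x_{a,i}$ is the centroid of the $a$th cluster. $\|\cdot\|_{2\to2}$ is the spectral norm. $D$ is the $N\times N$ matrix of squared Euclidean distances between the points, and $X_D$ is a minimizer of $$\text{minimize } \operatorname{Tr}(DX)\quad\text{subject to}\quad \operatorname{Tr}(X)=k,\ X1=1,\ X\ge0 \text{ (entrywise)},\ X\succeq0 .$$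 *)

theory Defs
  imports "HOL-Probability.Probability" "Jordan_Normal_Form.Matrix"
begin

text \<open>Both ambient libraries use the name \<open>vec\<close> and the notation \<open>$\<close>.  From here on they refer to the
  vectors and matrices of variable dimension, because the dimensions \<open>m\<close>, \<open>k\<close>, \<open>n\<close> are quantified
  inside the statement.  Indices are 0-based throughout.\<close>

unbundle no vec_syntax
no_notation inner (infixl \<open>\<bullet>\<close> 70)
hide_type (open) Finite_Cartesian_Product.vec
hide_const (open) Finite_Cartesian_Product.vec Finite_Cartesian_Product.mat

definition l2norm :: "real vec \<Rightarrow> real" where
  "l2norm v = L2_set (\<lambda>i. v $ i) {..<dim_vec v}"

definition spectral_norm :: "real mat \<Rightarrow> real" where
  "spectral_norm A = (SUP v\<in>{v \<in> carrier_vec (dim_col A). l2norm v \<le> 1}. l2norm (A *\<^sub>v v))"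

definition mat_trace :: "real mat \<Rightarrow> real" where
  "mat_trace A = (\<Sum>i<dim_row A. A $$ (i, i))"

definition pos_semidef :: "real mat \<Rightarrow> bool" where
  "pos_semidef A \<longleftrightarrow> square_mat A \<and> transpose_mat A = A \<and>
     (\<forall>v \<in> carrier_vec (dim_row A). 0 \<le> v \<bullet> (A *\<^sub>v v))"

definition sq_dist_matrix :: "real mat \<Rightarrow> real mat" where
  "sq_dist_matrix P =
     mat (dim_col P) (dim_col P) (\<lambda>(r, s). (l2norm (col P r - col P s))\<^sup>2)"

definition sdp_feasible :: "nat \<Rightarrow> nat \<Rightarrow> real mat \<Rightarrow> bool" where
  "sdp_feasible k N X \<longleftrightarrow> X \<in> carrier_mat N N \<and> mat_trace X = real k \<and>
     X *\<^sub>v vec N (\<lambda>_. 1) = vec N (\<lambda>_. 1) \<and>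
     (\<forall>r<N. \<forall>s<N. 0 \<le> X $$ (r, s)) \<and> pos_semidef X"

definition sdp_minimizer :: "nat \<Rightarrow> real mat \<Rightarrow> real mat \<Rightarrow> bool" where
  "sdp_minimizer k D X \<longleftrightarrow> sdp_feasible k (dim_row D) X \<and>
     (\<forall>Y. sdp_feasible k (dim_row D) Y \<longrightarrow> mat_trace (D * X) \<le> mat_trace (D * Y))"

definition min_separation :: "nat \<Rightarrow> (nat \<Rightarrow> real vec) \<Rightarrow> real" where
  "min_separation k \<gamma> = Min {l2norm (\<gamma> a - \<gamma> b) | a b. a < k \<and> b < k \<and> a \<noteq> b}"

definition spherical_gaussian :: "real vec \<Rightarrow> real \<Rightarrow> (nat \<Rightarrow> real) measure" where
  "spherical_gaussian \<mu> \<sigma> =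
     PiM {..<dim_vec \<mu>} (\<lambda>j. density lborel (\<lambda>t. ennreal (normal_density (\<mu> $ j) \<sigma> t)))"

lemma spherical_gaussian_density:
  assumes "\<sigma> > 0"
  shows "spherical_gaussian \<mu> \<sigma> =
    density (PiM {..<dim_vec \<mu>} (\<lambda>_. lborel))
      (\<lambda>x. ennreal (exp (- (l2norm (vec (dim_vec \<mu>) x - \<mu>))\<^sup>2 / (2 * \<sigma>\<^sup>2)) /
             sqrt (2 * pi * \<sigma>\<^sup>2) ^ dim_vec \<mu>))"
proof -
  let ?m = "dim_vec \<mu>"
  let ?g = "\<lambda>j t. ennreal (normal_density (\<mu> $ j) \<sigma> t)"
  let ?f = "\<lambda>x. ennreal (exp (- (l2norm (vec ?m x - \<mu>))\<^sup>2 / (2 * \<sigma>\<^sup>2)) / sqrt (2 * pi * \<sigma>\<^sup>2) ^ ?m)"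
  have f_eq: "?f x = (\<Prod>j<?m. ?g j (x j))" for x :: "nat \<Rightarrow> real"
  proof -
    have "(l2norm (vec ?m x - \<mu>))\<^sup>2 = (\<Sum>j<?m. (x j - \<mu> $ j)\<^sup>2)"
      by (simp add: l2norm_def L2_set_def sum_nonneg)
    moreover have "(\<Prod>j<?m. normal_density (\<mu> $ j) \<sigma> (x j)) =
        exp (\<Sum>j<?m. - (x j - \<mu> $ j)\<^sup>2 / (2 * \<sigma>\<^sup>2)) / sqrt (2 * pi * \<sigma>\<^sup>2) ^ ?m"
      by (simp add: normal_density_def prod.distrib exp_sum prod_dividef)
    moreover have "(\<Sum>j<?m. - (x j - \<mu> $ j)\<^sup>2 / (2 * \<sigma>\<^sup>2)) =
        - (\<Sum>j<?m. (x j - \<mu> $ j)\<^sup>2) / (2 * \<sigma>\<^sup>2)"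
      by (simp add: sum_negf sum_divide_distrib)
    ultimately show ?thesis
      by (simp add: prod_ennreal)
  qed
  interpret G: prob_space "density lborel (?g j)" for j
    by (rule prob_space_normal_density) fact
  interpret PG: product_sigma_finite "\<lambda>j. density lborel (?g j)" ..
  interpret L: product_sigma_finite "\<lambda>_::nat. lborel :: real measure" ..
  have "density (PiM {..<?m} (\<lambda>_. lborel)) ?f = PiM {..<?m} (\<lambda>j. density lborel (?g j))"
  proof (rule PG.PiM_eqI)
    fix A :: "nat \<Rightarrow> real set"
    assume A: "\<And>i. i \<in> {..<?m} \<Longrightarrow> A i \<in> sets (density lborel (?g i))"
    then have A': "\<And>i. i < ?m \<Longrightarrow> A i \<in> sets borel" by simp
    have mf: "?f \<in> borel_measurable (PiM {..<?m} (\<lambda>_. lborel))"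
      unfolding f_eq by measurable
    have "Pi\<^sub>E {..<?m} A \<in> sets (PiM {..<?m} (\<lambda>_. lborel :: real measure))"
      using A' by (intro sets_PiM_I_finite) auto
    then have "emeasure (density (PiM {..<?m} (\<lambda>_. lborel)) ?f) (Pi\<^sub>E {..<?m} A) =
        (\<integral>\<^sup>+x. ?f x * indicator (Pi\<^sub>E {..<?m} A) x \<partial>PiM {..<?m} (\<lambda>_. lborel))"
      using mf by (rule emeasure_density[rotated])
    also have "\<dots> = (\<integral>\<^sup>+x. (\<Prod>j<?m. ?g j (x j) * indicator (A j) (x j)) \<partial>PiM {..<?m} (\<lambda>_. lborel))"
    proof (rule nn_integral_cong)
      fix x :: "nat \<Rightarrow> real" assume "x \<in> space (PiM {..<?m} (\<lambda>_. lborel))"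
      then have "(indicator (Pi\<^sub>E {..<?m} A) x :: ennreal) = (\<Prod>j<?m. indicator (A j) (x j))"
        by (auto simp: indicator_def space_PiM PiE_iff prod_zero_iff)
      then show "?f x * indicator (Pi\<^sub>E {..<?m} A) x = (\<Prod>j<?m. ?g j (x j) * indicator (A j) (x j))"
        by (simp only: f_eq prod.distrib)
    qed
    also have "\<dots> = (\<Prod>j<?m. \<integral>\<^sup>+t. ?g j t * indicator (A j) t \<partial>lborel)"
      using A' by (intro L.product_nn_integral_prod) auto
    also have "\<dots> = (\<Prod>j<?m. emeasure (density lborel (?g j)) (A j))"
      using A' by (intro prod.cong refl) (simp add: emeasure_density)
    finally show "emeasure (density (PiM {..<?m} (\<lambda>_. lborel)) ?f) (Pi\<^sub>E {..<?m} A) =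
        (\<Prod>j<?m. emeasure (density lborel (?g j)) (A j))" .
  qed (auto cong: sets_PiM_cong)
  then show ?thesis
    by (simp add: spherical_gaussian_def)
qed

text \<open>The joint law of the sample: \<open>\<omega> (a, i)\<close> holds the coordinates of the \<open>i\<close>th point of cluster \<open>a\<close>.\<close>

definition mixture_sample :: "nat \<Rightarrow> nat \<Rightarrow> (nat \<Rightarrow> real vec) \<Rightarrow> real \<Rightarrow> (nat \<times> nat \<Rightarrow> nat \<Rightarrow> real) measure" where
  "mixture_sample k n \<gamma> \<sigma> = PiM ({..<k} \<times> {..<n}) (\<lambda>(a, i). spherical_gaussian (\<gamma> a) \<sigma>)"

lemma prob_space_mixture_sample:
  assumes "\<sigma> > 0"
  shows "prob_space (mixture_sample k n \<gamma> \<sigma>)"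
  unfolding mixture_sample_def spherical_gaussian_def
  by (intro prob_space_PiM) (auto intro!: prob_space_PiM prob_space_normal_density assms)

text \<open>The pair index \<open>(a, i)\<close> is encoded as the column index \<open>a * n + i\<close>.\<close>

definition data_matrix :: "nat \<Rightarrow> nat \<Rightarrow> nat \<Rightarrow> (nat \<times> nat \<Rightarrow> nat \<Rightarrow> real) \<Rightarrow> real mat" where
  "data_matrix m k n \<omega> = mat m (k * n) (\<lambda>(j, r). \<omega> (r div n, r mod n) j)"

lemma col_data_matrix:
  assumes "a < k" "i < n"
  shows "col (data_matrix m k n \<omega>) (a * n + i) = vec m (\<omega> (a, i))"
proof -
  have "a * n + i < Suc a * n" using assms by simp
  also have "\<dots> \<le> k * n" using assms by (intro mult_le_mono) auto
  finally show ?thesis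
    using assms by (auto simp: data_matrix_def vec_eq_iff)
qed

definition centroid :: "nat \<Rightarrow> real mat \<Rightarrow> nat \<Rightarrow> real vec" where
  "centroid n P a = vec (dim_row P) (\<lambda>j. (\<Sum>i<n. P $$ (j, a * n + i)) / real n)"

definition centered_centroids :: "nat \<Rightarrow> nat \<Rightarrow> real mat \<Rightarrow> real mat" where
  "centered_centroids k n P =
     mat (dim_row P) k (\<lambda>(j, a). centroid n P a $ j - (\<Sum>b<k. centroid n P b $ j) / real k)"

text \<open>\<open>Q n\<close> is not required to be a measurable set; it only has to contain
  measurable events whose probability tends to 1.\<close>

definition with_high_probability :: "(nat \<Rightarrow> 'a measure) \<Rightarrow> (nat \<Rightarrow> 'a \<Rightarrow> bool) \<Rightarrow> bool" where
  "with_high_probability M Q \<longleftrightarrow>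
     (\<exists>E. (\<forall>n. E n \<in> sets (M n)) \<and> (\<forall>n. \<forall>\<omega>\<in>E n. Q n \<omega>) \<and>
          (\<lambda>n. measure (M n) (E n)) \<longlonglongrightarrow> 1)"

end

theory Submission
  imports Defs
begin

text \<open>Write every point as \<open>\<mu> + \<rho>\<close> with \<open>\<mu>\<close> the centroid of its cluster, and let \<open>\<mu>\<^sub>j, \<rho>\<^sub>j \<in> \<real>\<^sup>N\<close> collect the
  \<open>j\<close>th coordinates.  A feasible \<open>X\<close> satisfies \<open>0 \<preceq> X \<preceq> 1\<close>, and up to the factor \<open>2\<close> its objective value is
  \<open>\<Sum>j. \<langle>\<mu>\<^sub>j + \<rho>\<^sub>j, L (\<mu>\<^sub>j + \<rho>\<^sub>j)\<rangle>\<close> with \<open>L = 1 - X\<close>.  Comparison with the block averaging matrix, whose value is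
  \<open>\<Sum>j. \<parallel>\<rho>\<^sub>j\<parallel>\<^sup>2\<close>, gives for \<open>T = \<Sum>j. \<langle>\<mu>\<^sub>j, L \<mu>\<^sub>j\<rangle>\<close> the inequality
  \<open>T \<le> - 2 \<Sum>j. \<langle>\<mu>\<^sub>j, L \<rho>\<^sub>j\<rangle> + \<Sum>j. \<langle>\<rho>\<^sub>j, X \<rho>\<^sub>j\<rangle>\<close>.

  Let \<open>B\<close> bound the squared spectral norm of the noise matrix \<open>\<rho>\<close>.  The last sum is at most \<open>B tr X = k B\<close>.
  Since the centroids span at most \<open>k\<close> dimensions, the cross term splits into \<open>k\<close> terms
  \<open>- 2 \<langle>a, L b\<rangle> \<le> \<langle>a, L a\<rangle> / 2 + 2 \<langle>b, L b\<rangle>\<close> with \<open>\<langle>b, L b\<rangle> \<le> B\<close>, so it is at most \<open>T / 2 + 2 k B\<close>.  Hence \<open>T \<le> 6 k B\<close>.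
  The error vectors are \<open>X \<rho>\<^sub>j - L \<mu>\<^sub>j\<close>, and \<open>X\<^sup>2 \<preceq> X\<close>, \<open>L\<^sup>2 \<preceq> L\<close> bound their total squared length by \<open>2 T + 2 k B \<le> 14 k B\<close>.

  For fixed \<open>m\<close> and \<open>k\<close> the weak law of large numbers gives \<open>B = 2 N \<sigma>\<^sup>2\<close> and \<open>\<parallel>\<Gamma>\<parallel> \<ge> \<Delta> / 4\<close> with high probability, so
  the mean error is at most \<open>28 k \<sigma>\<^sup>2 \<le> 448 (\<parallel>\<Gamma>\<parallel>\<^sup>2 / \<Delta>\<^sup>2) k \<sigma>\<^sup>2\<close>.\<close>

subsection \<open>Forms between \<open>0\<close> and \<open>1\<close>\<close>

text \<open>Matrices and vectors are plain functions on an index set, so points, clusters and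
  coordinates need no carrier conditions. Forms only see the values on \<open>I\<close>.\<close>

definition mat_app :: "'i set \<Rightarrow> ('i \<Rightarrow> 'i \<Rightarrow> real) \<Rightarrow> ('i \<Rightarrow> real) \<Rightarrow> 'i \<Rightarrow> real" where
  "mat_app I A v r = (\<Sum>s\<in>I. A r s * v s)"

definition bform :: "'i set \<Rightarrow> ('i \<Rightarrow> 'i \<Rightarrow> real) \<Rightarrow> ('i \<Rightarrow> real) \<Rightarrow> ('i \<Rightarrow> real) \<Rightarrow> real" where
  "bform I A u v = (\<Sum>r\<in>I. u r * mat_app I A v r)"

definition psd_on :: "'i set \<Rightarrow> ('i \<Rightarrow> 'i \<Rightarrow> real) \<Rightarrow> bool" where
  "psd_on I A \<longleftrightarrow> (\<forall>r\<in>I. \<forall>s\<in>I. A r s = A s r) \<and> (\<forall>v. 0 \<le> bform I A v v)"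

definition compl_mat :: "('i \<Rightarrow> 'i \<Rightarrow> real) \<Rightarrow> 'i \<Rightarrow> 'i \<Rightarrow> real" where
  "compl_mat A r s = of_bool (r = s) - A r s"

lemma mat_app_add: "mat_app I A (\<lambda>r. u r + v r) r = mat_app I A u r + mat_app I A v r"
  by (simp add: mat_app_def algebra_simps sum.distrib)

lemma mat_app_scale: "mat_app I A (\<lambda>r. t * v r) r = t * mat_app I A v r"
  by (simp add: mat_app_def sum_distrib_left mult_ac)

lemma bform_add_left: "bform I A (\<lambda>r. u r + v r) w = bform I A u w + bform I A v w"
  by (simp add: bform_def algebra_simps sum.distrib)

lemma bform_add_right: "bform I A w (\<lambda>r. u r + v r) = bform I A w u + bform I A w v"
  by (simp add: bform_def mat_app_add algebra_simps sum.distrib)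

lemma bform_scale_left: "bform I A (\<lambda>r. t * u r) w = t * bform I A u w"
  by (simp add: bform_def sum_distrib_left mult_ac)

lemma bform_scale_right: "bform I A w (\<lambda>r. t * u r) = t * bform I A w u"
  by (simp add: bform_def mat_app_scale sum_distrib_left mult_ac)

lemma bform_alt: "bform I A u v = (\<Sum>r\<in>I. \<Sum>s\<in>I. u r * A r s * v s)"
  by (simp add: bform_def mat_app_def sum_distrib_left mult_ac)

lemma bform_sym:
  assumes "psd_on I A"
  shows "bform I A u v = bform I A v u"
proof -
  have "bform I A u v = (\<Sum>s\<in>I. \<Sum>r\<in>I. u r * A r s * v s)"
    unfolding bform_alt by (rule sum.swap)
  also have "\<dots> = bform I A v u"
    unfolding bform_alt using assms by (intro sum.cong refl) (auto simp: psd_on_def mult_ac)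
  finally show ?thesis .
qed

lemma mat_app_compl:
  assumes "finite I" "r \<in> I"
  shows "mat_app I (compl_mat A) v r = v r - mat_app I A v r"
proof -
  have "mat_app I (compl_mat A) v r = (\<Sum>s\<in>I. (if r = s then v s else 0) - A r s * v s)"
    unfolding mat_app_def compl_mat_def by (intro sum.cong refl) (auto simp: algebra_simps)
  then show ?thesis
    using assms by (simp add: sum_subtractf mat_app_def)
qed

lemma bform_compl:
  assumes "finite I"
  shows "bform I (compl_mat A) u v = (\<Sum>r\<in>I. u r * v r) - bform I A u v"
  using assms by (simp add: bform_def mat_app_compl algebra_simps sum_subtractf)

lemma compl_mat_compl [simp]: "compl_mat (compl_mat A) = A"
  by (auto simp: compl_mat_def fun_eq_iff)

text \<open>\<open>A\<^sup>2 \<preceq> A\<close> for \<open>0 \<preceq> A \<preceq> 1\<close>, by evaluating the form of \<open>A\<close> at \<open>v - A v\<close>.\<close>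

lemma sum_mat_app_sq_le:
  assumes "finite I" "psd_on I A" "psd_on I (compl_mat A)"
  shows "(\<Sum>r\<in>I. (mat_app I A v r)\<^sup>2) \<le> bform I A v v"
proof -
  define w where "w = mat_app I A v"
  have wv: "bform I A w v = (\<Sum>r\<in>I. (w r)\<^sup>2)"
    by (simp add: bform_def w_def power2_eq_square)
  have "0 \<le> bform I (compl_mat A) w w"
    using assms(3) by (simp add: psd_on_def)
  then have ww: "bform I A w w \<le> (\<Sum>r\<in>I. (w r)\<^sup>2)"
    using assms(1) by (simp add: bform_compl power2_eq_square)
  have "0 \<le> bform I A (\<lambda>r. v r + (-1) * w r) (\<lambda>r. v r + (-1) * w r)"
    using assms(2) unfolding psd_on_def by blast
  also have "\<dots> = bform I A v v - 2 * bform I A w v + bform I A w w"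
    unfolding bform_add_left bform_add_right bform_scale_left bform_scale_right
    using bform_sym[OF assms(2), of v w] by simp
  finally show ?thesis
    using wv ww by (simp add: w_def)
qed

section \<open>Trace bound for semidefinite forms by elimination\<close>

lemma bform_unit_left:
  assumes "finite I" "r \<in> I"
  shows "bform I A (\<lambda>s. of_bool (s = r)) v = mat_app I A v r"
  using assms by (simp add: bform_def of_bool_def if_distrib[of "\<lambda>x. x * _"] cong: if_cong)

lemma bform_unit:
  assumes "finite I" "r \<in> I"
  shows "bform I A (\<lambda>s. of_bool (s = r)) (\<lambda>s. of_bool (s = r)) = A r r"
  unfolding bform_unit_left[OF assms]
  using assms by (simp add: mat_app_def of_bool_def if_distrib[of "\<lambda>x. _ * x"] cong: if_cong)

lemma psd_diag_nonneg:
  assumes "finite I" "psd_on I A" "r \<in> I"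
  shows "0 \<le> A r r"
  using assms(2) bform_unit[OF assms(1,3), of A] unfolding psd_on_def by metis

text \<open>Cauchy-Schwarz for the form of \<open>A\<close>, between \<open>v\<close> and the unit
  vector at \<open>r\<close>: the form at \<open>v\<close> plus \<open>t\<close> times the unit
  vector is a quadratic polynomial in \<open>t\<close> that never becomes negative.\<close>

lemma psd_mat_app_sq_le:
  assumes "finite I" "psd_on I A" "r \<in> I"
  shows "(mat_app I A v r)\<^sup>2 \<le> A r r * bform I A v v"
proof -
  let ?e = "\<lambda>s. of_bool (s = r) :: real"
  have ee: "bform I A ?e ?e = A r r"
    by (rule bform_unit[OF assms(1,3)])
  have "0 \<le> bform I A (\<lambda>s. v s + t * ?e s) (\<lambda>s. v s + t * ?e s)" for t
    using assms(2) unfolding psd_on_def by blast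
  then have quad: "0 \<le> bform I A v v + 2 * t * mat_app I A v r + t\<^sup>2 * A r r" for t
    unfolding bform_add_left bform_add_right bform_scale_left bform_scale_right
      bform_sym[OF assms(2), of v ?e] ee
    by (simp add: bform_unit_left[OF assms(1,3)] power2_eq_square algebra_simps)
  show ?thesis
  proof (cases "A r r = 0")
    case True
    have "mat_app I A v r = 0"
    proof (rule ccontr)
      assume n: "mat_app I A v r \<noteq> 0"
      \<comment> \<open>With vanishing leading coefficient the polynomial is affine in
        \<open>t\<close>; the chosen \<open>t\<close> gives it the value -1.\<close>
      show False
        using quad[of "- (bform I A v v + 1) / (2 * mat_app I A v r)"] n True by (simp add: field_simps)
    qed
    then show ?thesis using True by simp
  next
    case False
    then have pos: "A r r > 0" using psd_diag_nonneg[OF assms] by simp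
    \<comment> \<open>Here \<open>t\<close> is the minimizer of the quadratic polynomial.\<close>
    then show ?thesis
      using quad[of "- mat_app I A v r / A r r"]
      by (simp add: field_simps power2_eq_square)
  qed
qed

lemma psd_zero_row:
  assumes "finite I" "psd_on I A" "r \<in> I" "A r r = 0" "s \<in> I"
  shows "A r s = 0"
  using psd_mat_app_sq_le[OF assms(1-3), of "\<lambda>t. of_bool (t = s)"] assms
  by (simp add: mat_app_def)

text \<open>This is the Schur complement with respect to the diagonal entry at \<open>r\<close>. The
  value of the form at \<open>v\<close> drops by \<open>(mat_app I A v r)\<^sup>2 / A r r\<close>,
  which Cauchy-Schwarz keeps below \<open>bform I A v v\<close>.\<close>

lemma psd_peel:
  assumes "finite I" "psd_on I A" "r \<in> I" "A r r \<noteq> 0"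
  shows "psd_on I (\<lambda>s t. A s t - A r s * A r t / A r r)"
proof -
  have pos: "A r r > 0" using psd_diag_nonneg[OF assms(1-3)] assms(4) by simp
  have "bform I (\<lambda>s t. A s t - A r s * A r t / A r r) v v =
      bform I A v v - (mat_app I A v r)\<^sup>2 / A r r" for v
  proof -
    have "(mat_app I A v r)\<^sup>2 / A r r = (\<Sum>s\<in>I. \<Sum>t\<in>I. v s * (A r s * A r t / A r r) * v t)"
      unfolding mat_app_def power2_eq_square sum_product sum_divide_distrib
      by (intro sum.cong refl) (simp add: mult_ac)
    then show ?thesis
      by (simp add: bform_alt algebra_simps sum_subtractf)
  qed
  moreover have "(mat_app I A v r)\<^sup>2 / A r r \<le> bform I A v v" for v
    using psd_mat_app_sq_le[OF assms(1-3), of v] pos by (simp add: field_simps)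
  ultimately show ?thesis
    using assms(2) by (simp add: psd_on_def)
qed

text \<open>Cholesky decomposition: each step subtracts the rank-one matrix spanned by a row, until no row in \<open>S\<close> is left.\<close>

lemma psd_trace_le_aux:
  assumes "finite I" "finite S" "S \<subseteq> I" "psd_on I A"
    and "\<And>r s. r \<in> I - S \<Longrightarrow> s \<in> I \<Longrightarrow> A r s = 0"
    and B: "\<And>w. (\<Sum>j\<in>J. (\<Sum>r\<in>I. R r j * w r)\<^sup>2) \<le> B * (\<Sum>r\<in>I. (w r)\<^sup>2)"
  shows "(\<Sum>j\<in>J. bform I A (\<lambda>r. R r j) (\<lambda>r. R r j)) \<le> B * (\<Sum>r\<in>I. A r r)"
  using assms(2-5)
proof (induction S arbitrary: A rule: finite_induct)
  case empty
  then show ?case by (simp add: bform_alt)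
next
  case (insert i S)
  have i: "i \<in> I" using insert.prems by auto
  note psd = insert.prems(2)
  show ?case
  proof (cases "A i i = 0")
    case True
    then have "A i s = 0" if "s \<in> I" for s
      using psd_zero_row[OF assms(1) psd i] that by blast
    then have "r \<in> I - S \<Longrightarrow> s \<in> I \<Longrightarrow> A r s = 0" for r s
      using insert.prems(3)[of r s] by (cases "r = i") auto
    then show ?thesis using insert by blast
  next
    case False
    define A' where "A' = (\<lambda>s t. A s t - A i s * A i t / A i i)"
    have pos: "A i i > 0" using psd_diag_nonneg[OF assms(1) psd i] False by simp
    have "A' r s = 0" if "r \<in> I - S" "s \<in> I" for r s
    proof (cases "r = i")
      case True
      then show ?thesis using False by (simp add: A'_def)
    next
      case False
      then have z: "A r t = 0" if "t \<in> I" for t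
        using insert.prems(3)[of r t] that \<open>r \<in> I - S\<close> by auto
      have "A i r = A r i" using psd i \<open>r \<in> I - S\<close> by (auto simp: psd_on_def)
      then show ?thesis using z[OF i] z[OF that(2)] by (simp add: A'_def)
    qed
    then have IH: "(\<Sum>j\<in>J. bform I A' (\<lambda>r. R r j) (\<lambda>r. R r j)) \<le> B * (\<Sum>r\<in>I. A' r r)"
      using insert.IH[of A'] insert.prems(1) psd_peel[OF assms(1) psd i False]
      by (auto simp: A'_def)
    have bf: "bform I A u u = bform I A' u u + (\<Sum>r\<in>I. u r * A i r)\<^sup>2 / A i i" for u
    proof -
      have "(\<Sum>r\<in>I. u r * A i r)\<^sup>2 / A i i = (\<Sum>s\<in>I. \<Sum>t\<in>I. u s * (A i s * A i t / A i i) * u t)"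
        unfolding power2_eq_square sum_product sum_divide_distrib
        by (intro sum.cong refl) (simp add: mult_ac)
      then show ?thesis
        by (simp add: A'_def bform_alt algebra_simps sum_subtractf)
    qed
    have "(\<Sum>j\<in>J. bform I A (\<lambda>r. R r j) (\<lambda>r. R r j)) =
        (\<Sum>j\<in>J. bform I A' (\<lambda>r. R r j) (\<lambda>r. R r j)) + (\<Sum>j\<in>J. (\<Sum>r\<in>I. R r j * A i r)\<^sup>2) / A i i"
      by (simp add: bf sum.distrib sum_divide_distrib)
    \<comment> \<open>The hypothesis on \<open>R\<close> is used at the removed row
      \<open>A i\<close>. The rank-one part has trace
      \<open>(\<Sum>r\<in>I. (A i r)\<^sup>2) / A i i\<close>, so both bounds add up to
      \<open>B\<close> times the trace of \<open>A\<close>.\<close>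
    also have "\<dots> \<le> B * (\<Sum>r\<in>I. A' r r) + B * (\<Sum>r\<in>I. (A i r)\<^sup>2) / A i i"
      using IH B[of "A i"] pos by (intro add_mono divide_right_mono) auto
    also have "\<dots> = B * (\<Sum>r\<in>I. A r r)"
      by (simp add: A'_def sum_subtractf sum_divide_distrib[symmetric] power2_eq_square algebra_simps)
    finally show ?thesis .
  qed
qed

text \<open>In matrix notation: tr(R^T A R) \<le> B tr A whenever R R^T \<preceq> B. With
  \<open>A\<close> the solution of the program and \<open>R\<close> the noise, the trace constraint
  turns the right side into \<open>k\<close> times \<open>B\<close>.\<close>

lemma psd_trace_le:
  assumes "finite I" "psd_on I A"
    and "\<And>w. (\<Sum>j\<in>J. (\<Sum>r\<in>I. R r j * w r)\<^sup>2) \<le> B * (\<Sum>r\<in>I. (w r)\<^sup>2)"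
  shows "(\<Sum>j\<in>J. bform I A (\<lambda>r. R r j) (\<lambda>r. R r j)) \<le> B * (\<Sum>r\<in>I. A r r)"
  using psd_trace_le_aux[OF assms(1) assms(1) _ assms(2) _ assms(3)] by simp

text \<open>A matrix and its transpose have the same norm: by Cauchy-Schwarz the squared length
  \<open>Y\<close> of the transposed image satisfies
  \<open>Y\<^sup>2 \<le> \<parallel>w\<parallel>\<^sup>2 * (B * Y)\<close>, and one factor
  \<open>Y\<close> cancels.\<close>

lemma operator_bound_transpose:
  fixes R :: "'i \<Rightarrow> 'j \<Rightarrow> real"
  assumes "0 \<le> B"
    and bd: "\<And>v. (\<Sum>r\<in>I. (\<Sum>j\<in>J. R r j * v j)\<^sup>2) \<le> B * (\<Sum>j\<in>J. (v j)\<^sup>2)"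
  shows "(\<Sum>j\<in>J. (\<Sum>r\<in>I. R r j * w r)\<^sup>2) \<le> B * (\<Sum>r\<in>I. (w r)\<^sup>2)"
proof -
  define y where "y j = (\<Sum>r\<in>I. R r j * w r)" for j
  define Y where "Y = (\<Sum>j\<in>J. (y j)\<^sup>2)"
  have "Y = (\<Sum>r\<in>I. w r * (\<Sum>j\<in>J. R r j * y j))"
    unfolding Y_def power2_eq_square sum_distrib_left
    by (subst sum.swap) (simp add: y_def sum_distrib_left sum_distrib_right mult_ac)
  then have "Y\<^sup>2 \<le> (\<Sum>r\<in>I. (w r)\<^sup>2) * (\<Sum>r\<in>I. (\<Sum>j\<in>J. R r j * y j)\<^sup>2)"
    using Cauchy_Schwarz_ineq_sum[of w "\<lambda>r. \<Sum>j\<in>J. R r j * y j" I] by simp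
  also have "\<dots> \<le> (\<Sum>r\<in>I. (w r)\<^sup>2) * (B * Y)"
    unfolding Y_def by (intro mult_left_mono bd sum_nonneg) auto
  finally have "Y * Y \<le> (B * (\<Sum>r\<in>I. (w r)\<^sup>2)) * Y"
    by (simp add: power2_eq_square mult_ac)
  moreover have "0 \<le> Y" "0 \<le> B * (\<Sum>r\<in>I. (w r)\<^sup>2)"
    using assms(1) by (auto simp: Y_def intro!: sum_nonneg mult_nonneg_nonneg)
  ultimately have "Y \<le> B * (\<Sum>r\<in>I. (w r)\<^sup>2)"
    by (cases "Y = 0") (auto simp: mult_le_cancel_right)
  then show ?thesis by (simp add: Y_def y_def)
qed

section \<open>Doubly stochastic matrices and their Dirichlet forms\<close>

text \<open>The matrix 1 - X is the Laplacian of the weighted graph with weights \<open>X\<close>.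
  Expanding the square produces two diagonal sums, which become squared norms because rows, and by
  symmetry columns, sum to 1.\<close>

lemma doubly_stochastic_bform:
  assumes "finite I" and sym: "\<And>r s. r \<in> I \<Longrightarrow> s \<in> I \<Longrightarrow> X r s = X s r"
    and row: "\<And>r. r \<in> I \<Longrightarrow> (\<Sum>s\<in>I. X r s) = 1"
  shows "bform I (compl_mat X) v v = (\<Sum>r\<in>I. \<Sum>s\<in>I. X r s * (v r - v s)\<^sup>2) / 2"
proof -
  have "(\<Sum>r\<in>I. \<Sum>s\<in>I. X r s * (v r - v s)\<^sup>2) =
      (\<Sum>r\<in>I. \<Sum>s\<in>I. X r s * (v r)\<^sup>2) + (\<Sum>r\<in>I. \<Sum>s\<in>I. X r s * (v s)\<^sup>2)
        - 2 * (\<Sum>r\<in>I. \<Sum>s\<in>I. v r * X r s * v s)"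
    by (simp add: power2_diff algebra_simps sum.distrib sum_subtractf sum_distrib_left)
  moreover have "(\<Sum>r\<in>I. \<Sum>s\<in>I. X r s * (v r)\<^sup>2) = (\<Sum>r\<in>I. (v r)\<^sup>2)"
    by (simp add: row flip: sum_distrib_right)
  moreover have "(\<Sum>r\<in>I. \<Sum>s\<in>I. X r s * (v s)\<^sup>2) = (\<Sum>r\<in>I. \<Sum>s\<in>I. X r s * (v r)\<^sup>2)"
    by (subst sum.swap) (intro sum.cong refl, simp add: sym)
  ultimately show ?thesis
    using assms(1) by (simp add: bform_compl power2_eq_square) (simp add: bform_alt)
qed

text \<open>The weights of the Dirichlet form are nonnegative. This is how the constraints X1 = 1
  and X \<ge> 0 yield X \<preceq> 1.\<close>

lemma doubly_stochastic_compl_psd: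
  assumes "finite I" "\<And>r s. r \<in> I \<Longrightarrow> s \<in> I \<Longrightarrow> X r s = X s r"
    and "\<And>r. r \<in> I \<Longrightarrow> (\<Sum>s\<in>I. X r s) = 1"
    and "\<And>r s. r \<in> I \<Longrightarrow> s \<in> I \<Longrightarrow> 0 \<le> X r s"
  shows "psd_on I (compl_mat X)"
  unfolding psd_on_def
  using assms by (auto simp: doubly_stochastic_bform compl_mat_def intro!: sum_nonneg)

text \<open>Gram--Schmidt; the vectors \<open>u t\<close> are allowed to vanish, which avoids tracking the rank.\<close>

lemma gram_schmidt:
  fixes v :: "nat \<Rightarrow> 'j \<Rightarrow> real"
  assumes "finite J"
  shows "\<exists>u. (\<forall>t<k. (\<Sum>j\<in>J. u t j * u t j) \<in> {0, 1}) \<and>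
    (\<forall>s<k. \<forall>t<k. s \<noteq> t \<longrightarrow> (\<Sum>j\<in>J. u s j * u t j) = 0) \<and>
    (\<forall>a<k. \<forall>j\<in>J. v a j = (\<Sum>t<k. (\<Sum>l\<in>J. v a l * u t l) * u t j))"
proof (induction k)
  case 0
  then show ?case by simp
next
  case (Suc k)
  then obtain u where u1: "\<And>t. t < k \<Longrightarrow> (\<Sum>j\<in>J. u t j * u t j) \<in> {0, 1}"
    and u2: "\<And>s t. s < k \<Longrightarrow> t < k \<Longrightarrow> s \<noteq> t \<Longrightarrow> (\<Sum>j\<in>J. u s j * u t j) = 0"
    and u3: "\<And>a j. a < k \<Longrightarrow> j \<in> J \<Longrightarrow> v a j = (\<Sum>t<k. (\<Sum>l\<in>J. v a l * u t l) * u t j)"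
    by blast
  define ip where "ip x y = (\<Sum>j\<in>J. x j * y j)" for x y :: "'j \<Rightarrow> real"
  have ip_sym: "ip x y = ip y x" for x y by (simp add: ip_def mult.commute)
  have ip_comb: "ip (\<lambda>j. \<Sum>t<k. c t * u t j) y = (\<Sum>t<k. c t * ip (u t) y)" for c y
    unfolding ip_def sum_distrib_right sum_distrib_left
    by (subst sum.swap) (simp add: mult_ac)
  define w where "w j = v k j - (\<Sum>t<k. ip (v k) (u t) * u t j)" for j
  define d where "d = sqrt (ip w w)"
  \<comment> \<open>If \<open>v k\<close> already lies in the span, then \<open>d = 0\<close> and
    division by zero makes the new vector zero, as the statement permits.\<close>
  define u' where "u' = u(k := (\<lambda>j. w j / d))"
  have ww: "0 \<le> ip w w" by (simp add: ip_def sum_nonneg)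
  then have d2: "d * d = ip w w" by (simp add: d_def)
  have w0: "w j = 0" if "d = 0" "j \<in> J" for j
    using d2 that assms by (simp add: ip_def sum_nonneg_eq_0_iff)
  \<comment> \<open>The vectors have length 0 or 1; in the first case \<open>u s\<close> vanishes on
    \<open>J\<close> and so do both sides.\<close>
  have uu: "ip x (u s) * ip (u s) (u s) = ip x (u s)" if "s < k" for s x
  proof (cases "ip (u s) (u s) = 0")
    case True
    then have "u s j = 0" if "j \<in> J" for j using that assms by (simp add: ip_def sum_nonneg_eq_0_iff)
    then show ?thesis by (simp add: ip_def)
  next
    case False
    then show ?thesis using u1[OF that] by (simp add: ip_def)
  qed
  have w_orth: "ip (u s) w = 0" if "s < k" for s
  proof -
    have "ip w (u s) = ip (v k) (u s) - ip (\<lambda>j. \<Sum>t<k. ip (v k) (u t) * u t j) (u s)"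
      by (simp add: ip_def w_def algebra_simps sum_subtractf)
    also have "ip (\<lambda>j. \<Sum>t<k. ip (v k) (u t) * u t j) (u s) = (\<Sum>t<k. if t = s then ip (v k) (u s) else 0)"
      unfolding ip_comb using that uu u2 by (intro sum.cong refl) (auto simp: ip_def)
    finally show ?thesis using that by (simp add: ip_sym)
  qed
  have v_orth: "ip (v a) w = 0" if "a < k" for a
  proof -
    have "ip (v a) w = ip (\<lambda>j. \<Sum>t<k. ip (v a) (u t) * u t j) w"
      using u3[OF that] unfolding ip_def by (intro sum.cong refl) auto
    also have "\<dots> = 0" unfolding ip_comb by (simp add: w_orth)
    finally show ?thesis .
  qed
  have vk: "ip (v k) w = ip w w"
  proof -
    have "ip (v k) w = ip w w + ip (\<lambda>j. \<Sum>t<k. ip (v k) (u t) * u t j) w"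
      unfolding ip_def sum.distrib[symmetric] by (intro sum.cong refl) (simp add: w_def ip_def algebra_simps)
    also have "\<dots> = ip w w" unfolding ip_comb by (simp add: w_orth)
    finally show ?thesis .
  qed
  have ip_div: "ip x (\<lambda>j. y j / d) = ip x y / d" "ip (\<lambda>j. y j / d) x = ip y x / d" for x y
    by (simp_all add: ip_def sum_divide_distrib)
  have 1: "ip (u' t) (u' t) \<in> {0, 1}" if "t < Suc k" for t
  proof (cases "t = k")
    case True
    then have "ip (u' t) (u' t) = ip w w / (d * d)" by (simp add: u'_def ip_div)
    then show ?thesis using d2 by simp
  next
    case False
    then show ?thesis using u1[of t] that by (simp add: u'_def ip_def)
  qed
  have 2: "ip (u' s) (u' t) = 0" if "s < Suc k" "t < Suc k" "s \<noteq> t" for s t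
    using that u2[of s t] w_orth[of s] w_orth[of t]
    by (auto simp: u'_def ip_div ip_sym[of w] less_Suc_eq) (simp_all add: ip_def)
  have 3: "v a j = (\<Sum>t<Suc k. ip (v a) (u' t) * u' t j)" if "a < Suc k" "j \<in> J" for a j
  proof -
    have "(\<Sum>t<Suc k. ip (v a) (u' t) * u' t j) =
        (\<Sum>t<k. ip (v a) (u t) * u t j) + ip (v a) w / (d * d) * w j"
      by (simp add: u'_def ip_div)
    also have "\<dots> = v a j"
    proof (cases "a = k")
      case True
      then show ?thesis using w0[OF _ that(2)] d2 vk
        by (cases "d = 0") (auto simp: w_def)
    next
      case False
      then show ?thesis using u3[of a j] that v_orth[of a] by (simp add: ip_def)
    qed
    finally show ?thesis by simp
  qed
  show ?case
    using 1 2 3 unfolding ip_def by (intro exI[of _ u']) blast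
qed

section \<open>The deterministic error bound\<close>

text \<open>Factoring \<open>\<mu>\<close> through the cluster labels \<open>cl\<close> shows that
  only the \<open>k\<close> vectors \<open>g a\<close> occur, so Gram-Schmidt yields
  \<open>k\<close> directions however large \<open>J\<close> is. In \<open>opt\<close> the right
  side is half the objective value of the block averaging matrix.\<close>

lemma sdp_error_bound:
  fixes \<mu> \<rho> :: "'i \<Rightarrow> 'j \<Rightarrow> real" and k :: nat and cl :: "'i \<Rightarrow> nat"
  assumes fin: "finite I" "finite J"
    and psd: "psd_on I X" and psdc: "psd_on I (compl_mat X)"
    and tr: "(\<Sum>r\<in>I. X r r) = real k"
    and B: "0 \<le> B" "\<And>v. (\<Sum>r\<in>I. (\<Sum>j\<in>J. \<rho> r j * v j)\<^sup>2) \<le> B * (\<Sum>j\<in>J. (v j)\<^sup>2)"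
    and cl: "\<And>r. r \<in> I \<Longrightarrow> cl r < k" "\<And>r j. r \<in> I \<Longrightarrow> j \<in> J \<Longrightarrow> \<mu> r j = g (cl r) j"
    and opt: "(\<Sum>j\<in>J. bform I (compl_mat X) (\<lambda>r. \<mu> r j + \<rho> r j) (\<lambda>r. \<mu> r j + \<rho> r j))
      \<le> (\<Sum>j\<in>J. \<Sum>r\<in>I. (\<rho> r j)\<^sup>2)"
  shows "(\<Sum>j\<in>J. \<Sum>r\<in>I. (mat_app I X (\<lambda>r. \<mu> r j + \<rho> r j) r - \<mu> r j)\<^sup>2) \<le> 14 * real k * B"
proof -
  let ?L = "bform I (compl_mat X)"
  obtain u where u1: "\<And>t. t < k \<Longrightarrow> (\<Sum>j\<in>J. u t j * u t j) \<in> {0, 1}"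
    and u2: "\<And>s t. s < k \<Longrightarrow> t < k \<Longrightarrow> s \<noteq> t \<Longrightarrow> (\<Sum>j\<in>J. u s j * u t j) = 0"
    and u3: "\<And>a j. a < k \<Longrightarrow> j \<in> J \<Longrightarrow> g a j = (\<Sum>t<k. (\<Sum>l\<in>J. g a l * u t l) * u t j)"
    using gram_schmidt[OF fin(2), of k g] by blast
  define a where "a t r = (\<Sum>j\<in>J. \<mu> r j * u t j)" for t r
  define b where "b t r = (\<Sum>j\<in>J. \<rho> r j * u t j)" for t r
  define T where "T = (\<Sum>j\<in>J. ?L (\<lambda>r. \<mu> r j) (\<lambda>r. \<mu> r j))"
  have mu: "\<mu> r j = (\<Sum>t<k. a t r * u t j)" if "r \<in> I" "j \<in> J" for r j
    using u3[OF cl(1)[OF that(1)] that(2)] cl(2)[OF that(1)] that by (simp add: a_def)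
  \<comment> \<open>Only \<open>\<mu>\<close> is expanded in the directions \<open>u t\<close>; the
    other argument need not lie in their span. This replaces the sum over coordinates by one over
    \<open>k\<close> directions, both for the cross term and for \<open>T\<close>.\<close>
  have split: "(\<Sum>j\<in>J. ?L (\<lambda>r. \<mu> r j) (\<lambda>r. y r j)) = (\<Sum>t<k. ?L (a t) (\<lambda>r. \<Sum>j\<in>J. y r j * u t j))" for y
  proof -
    have "(\<Sum>j\<in>J. ?L (\<lambda>r. \<mu> r j) (\<lambda>r. y r j)) =
        (\<Sum>j\<in>J. \<Sum>r\<in>I. \<Sum>s\<in>I. \<Sum>t<k. a t r * u t j * compl_mat X r s * y s j)"
      unfolding bform_alt
      by (intro sum.cong refl) (simp add: mu sum_distrib_right)
    also have "\<dots> = (\<Sum>r\<in>I. \<Sum>j\<in>J. \<Sum>s\<in>I. \<Sum>t<k. a t r * u t j * compl_mat X r s * y s j)"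
      by (rule sum.swap)
    also have "\<dots> = (\<Sum>r\<in>I. \<Sum>s\<in>I. \<Sum>j\<in>J. \<Sum>t<k. a t r * u t j * compl_mat X r s * y s j)"
      by (intro sum.cong refl) (rule sum.swap)
    also have "\<dots> = (\<Sum>r\<in>I. \<Sum>s\<in>I. \<Sum>t<k. \<Sum>j\<in>J. a t r * u t j * compl_mat X r s * y s j)"
      by (intro sum.cong refl) (rule sum.swap)
    also have "\<dots> = (\<Sum>r\<in>I. \<Sum>t<k. \<Sum>s\<in>I. \<Sum>j\<in>J. a t r * u t j * compl_mat X r s * y s j)"
      by (intro sum.cong refl) (rule sum.swap)
    also have "\<dots> = (\<Sum>t<k. \<Sum>r\<in>I. \<Sum>s\<in>I. \<Sum>j\<in>J. a t r * u t j * compl_mat X r s * y s j)"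
      by (rule sum.swap)
    also have "\<dots> = (\<Sum>t<k. ?L (a t) (\<lambda>r. \<Sum>j\<in>J. y r j * u t j))"
      unfolding bform_alt by (simp add: sum_distrib_left mult_ac)
    finally show ?thesis .
  qed
  have Lpos: "0 \<le> ?L v v" for v using psdc by (simp add: psd_on_def)
  have L_le: "?L v v \<le> (\<Sum>r\<in>I. (v r)\<^sup>2)" for v
    using psd fin by (simp add: bform_compl psd_on_def power2_eq_square)
  have T_a: "T = (\<Sum>t<k. ?L (a t) (a t))"
    unfolding T_def split by (simp add: a_def[abs_def])
  have rho_q: "(\<Sum>j\<in>J. bform I X (\<lambda>r. \<rho> r j) (\<lambda>r. \<rho> r j)) \<le> B * real k"
    using psd_trace_le[OF fin(1) psd operator_bound_transpose[OF B]] tr by simp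
  have cross: "- (2 * (\<Sum>j\<in>J. ?L (\<lambda>r. \<mu> r j) (\<lambda>r. \<rho> r j))) \<le> T / 2 + 2 * (real k * B)"
  proof -
    \<comment> \<open>Half the nonnegative value of the form at \<open>a t + 2 * b t\<close> is the
      weighted Young inequality; the weights leave half of \<open>T\<close> to be absorbed
      later.\<close>
    have one: "- (2 * ?L (a t) (b t)) \<le> ?L (a t) (a t) / 2 + 2 * B" if "t < k" for t
    proof -
      have "0 \<le> ?L (\<lambda>r. a t r + 2 * b t r) (\<lambda>r. a t r + 2 * b t r)" by (rule Lpos)
      also have "\<dots> = ?L (a t) (a t) + 4 * ?L (a t) (b t) + 4 * ?L (b t) (b t)"
        unfolding bform_add_left bform_add_right bform_scale_left bform_scale_right
        using bform_sym[OF psdc, of "a t" "b t"] by simp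
      finally have 1: "- (2 * ?L (a t) (b t)) \<le> ?L (a t) (a t) / 2 + 2 * ?L (b t) (b t)" by simp
      have "?L (b t) (b t) \<le> B * (\<Sum>j\<in>J. (u t j)\<^sup>2)"
        using L_le[of "b t"] B(2)[of "u t"] by (simp add: b_def)
      also have "\<dots> \<le> B * 1"
        using B(1) u1[OF that] by (intro mult_left_mono) (auto simp: power2_eq_square)
      finally show ?thesis using 1 by simp
    qed
    have "- (2 * (\<Sum>j\<in>J. ?L (\<lambda>r. \<mu> r j) (\<lambda>r. \<rho> r j))) = (\<Sum>t<k. - (2 * ?L (a t) (b t)))"
      unfolding split by (simp add: b_def[abs_def] sum_distrib_left sum_negf)
    also have "\<dots> \<le> (\<Sum>t<k. ?L (a t) (a t) / 2 + 2 * B)"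
      by (intro sum_mono one) auto
    also have "\<dots> = T / 2 + 2 * (real k * B)"
      by (simp add: T_a sum.distrib sum_divide_distrib)
    finally show ?thesis .
  qed
  have "(\<Sum>j\<in>J. ?L (\<lambda>r. \<mu> r j + \<rho> r j) (\<lambda>r. \<mu> r j + \<rho> r j)) =
      T + 2 * (\<Sum>j\<in>J. ?L (\<lambda>r. \<mu> r j) (\<lambda>r. \<rho> r j)) + (\<Sum>j\<in>J. ?L (\<lambda>r. \<rho> r j) (\<lambda>r. \<rho> r j))"
    unfolding bform_add_left bform_add_right T_def
    by (simp add: bform_sym[OF psdc, of "\<lambda>r. \<rho> r j" "\<lambda>r. \<mu> r j" for j] sum.distrib sum_distrib_left)
  also have "(\<Sum>j\<in>J. ?L (\<lambda>r. \<rho> r j) (\<lambda>r. \<rho> r j)) =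
      (\<Sum>j\<in>J. \<Sum>r\<in>I. (\<rho> r j)\<^sup>2) - (\<Sum>j\<in>J. bform I X (\<lambda>r. \<rho> r j) (\<lambda>r. \<rho> r j))"
    using fin by (simp add: bform_compl power2_eq_square sum_subtractf)
  \<comment> \<open>Optimality reads \<open>T \<le> T / 2 + 2 * k * B + k * B\<close>, and solving
    for \<open>T\<close> gives the factor 6.\<close>
  finally have T6: "T \<le> 6 * (real k * B)"
    using opt cross rho_q by (simp add: mult.commute)
  have pt: "(mat_app I X (\<lambda>r. \<mu> r j + \<rho> r j) r - \<mu> r j)\<^sup>2 \<le>
      2 * (mat_app I (compl_mat X) (\<lambda>r. \<mu> r j) r)\<^sup>2 + 2 * (mat_app I X (\<lambda>r. \<rho> r j) r)\<^sup>2"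
    if "r \<in> I" for r j
  proof -
    have "mat_app I X (\<lambda>r. \<mu> r j + \<rho> r j) r - \<mu> r j =
        mat_app I X (\<lambda>r. \<rho> r j) r - mat_app I (compl_mat X) (\<lambda>r. \<mu> r j) r"
      using fin that by (simp add: mat_app_add mat_app_compl)
    moreover have "(x - y)\<^sup>2 \<le> 2 * y\<^sup>2 + 2 * x\<^sup>2" for x y :: real
      using zero_le_power2[of "x + y"] by (simp add: power2_eq_square algebra_simps)
    ultimately show ?thesis by simp
  qed
  have "(\<Sum>j\<in>J. \<Sum>r\<in>I. (mat_app I X (\<lambda>r. \<mu> r j + \<rho> r j) r - \<mu> r j)\<^sup>2) \<le>
      (\<Sum>j\<in>J. \<Sum>r\<in>I. 2 * (mat_app I (compl_mat X) (\<lambda>r. \<mu> r j) r)\<^sup>2 + 2 * (mat_app I X (\<lambda>r. \<rho> r j) r)\<^sup>2)"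
    by (intro sum_mono pt)
  also have "\<dots> = (\<Sum>j\<in>J. 2 * (\<Sum>r\<in>I. (mat_app I (compl_mat X) (\<lambda>r. \<mu> r j) r)\<^sup>2)
      + 2 * (\<Sum>r\<in>I. (mat_app I X (\<lambda>r. \<rho> r j) r)\<^sup>2))"
    by (simp add: sum.distrib sum_distrib_left)
  also have "\<dots> \<le> (\<Sum>j\<in>J. 2 * ?L (\<lambda>r. \<mu> r j) (\<lambda>r. \<mu> r j) + 2 * bform I X (\<lambda>r. \<rho> r j) (\<lambda>r. \<rho> r j))"
    using psd psdc fin by (intro sum_mono add_mono mult_left_mono sum_mat_app_sq_le) auto
  also have "\<dots> = 2 * T + 2 * (\<Sum>j\<in>J. bform I X (\<lambda>r. \<rho> r j) (\<lambda>r. \<rho> r j))"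
    by (simp add: T_def sum.distrib sum_distrib_left)
  \<comment> \<open>14 arises as 2 * 6 from \<open>T\<close> plus 2 from the noise.\<close>
  also have "\<dots> \<le> 14 * real k * B"
    using T6 rho_q by (simp add: mult.commute)
  finally show ?thesis .
qed

subsection \<open>The semidefinite program\<close>

lemma l2norm_sq: "(l2norm v)\<^sup>2 = (\<Sum>j<dim_vec v. (v $ j)\<^sup>2)"
  by (simp add: l2norm_def L2_set_def sum_nonneg)

lemma l2norm_nonneg: "0 \<le> l2norm v"
  by (simp add: l2norm_def)

text \<open>A supremum of reals dominates its members only if the set is bounded above; the
  Frobenius norm \<open>sqrt K\<close> provides the bound through Cauchy-Schwarz in each
  row.\<close>

lemma l2norm_mult_vec_le_spectral_norm:
  assumes "v \<in> carrier_vec (dim_col A)" "l2norm v \<le> 1"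
  shows "l2norm (A *\<^sub>v v) \<le> spectral_norm A"
proof -
  define K where "K = (\<Sum>i<dim_row A. \<Sum>j<dim_col A. (A $$ (i, j))\<^sup>2)"
  have "l2norm (A *\<^sub>v w) \<le> sqrt K" if w: "w \<in> carrier_vec (dim_col A)" "l2norm w \<le> 1" for w
  proof (rule real_le_rsqrt)
    have w1: "(\<Sum>j<dim_col A. (w $ j)\<^sup>2) \<le> 1"
      using l2norm_sq[of w] power_mono[OF w(2) l2norm_nonneg, of 2] w(1) by simp
    have "((A *\<^sub>v w) $ i)\<^sup>2 \<le> (\<Sum>j<dim_col A. (A $$ (i, j))\<^sup>2)" if "i < dim_row A" for i
    proof -
      have "(A *\<^sub>v w) $ i = (\<Sum>j<dim_col A. A $$ (i, j) * w $ j)"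
        using that w(1) by (simp add: scalar_prod_def atLeast0LessThan)
      then have "((A *\<^sub>v w) $ i)\<^sup>2 \<le> (\<Sum>j<dim_col A. (A $$ (i, j))\<^sup>2) * (\<Sum>j<dim_col A. (w $ j)\<^sup>2)"
        using Cauchy_Schwarz_ineq_sum by metis
      also have "\<dots> \<le> (\<Sum>j<dim_col A. (A $$ (i, j))\<^sup>2) * 1"
        using w1 by (intro mult_left_mono sum_nonneg) auto
      finally show ?thesis by simp
    qed
    then show "(l2norm (A *\<^sub>v w))\<^sup>2 \<le> K"
      unfolding l2norm_sq K_def by (auto intro!: sum_mono)
  qed
  then have "bdd_above ((\<lambda>v. l2norm (A *\<^sub>v v)) ` {v \<in> carrier_vec (dim_col A). l2norm v \<le> 1})"
    by (intro bdd_aboveI[of _ "sqrt K"]) auto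
  then show ?thesis
    unfolding spectral_norm_def using assms by (intro cSUP_upper) auto
qed

lemma block_index_less:
  fixes a i k n :: nat
  assumes "a < k" "i < n"
  shows "a * n + i < k * n"
proof -
  have "a * n + i < Suc a * n" using assms by simp
  also have "\<dots> \<le> k * n" using assms by (intro mult_le_mono) auto
  finally show ?thesis .
qed

lemma sum_blocks:
  fixes f :: "nat \<Rightarrow> real"
  shows "(\<Sum>r<k * n. f r) = (\<Sum>a<k. \<Sum>i<n. f (a * n + i))"
proof -
  have "(\<Sum>i<n. f (a * n + i)) = sum f {a * n..<a * n + n}" for a
    using sum.shift_bounds_nat_ivl[of f 0 "a * n" n] by (simp add: atLeast0LessThan add.commute)
  then show ?thesis by (simp add: sum.nat_group)
qed

section \<open>The program in terms of forms\<close>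

lemma pos_semidef_iff:
  assumes "X \<in> carrier_mat N N"
  shows "pos_semidef X \<longleftrightarrow> psd_on {..<N} (\<lambda>r s. X $$ (r, s))"
proof -
  have dim: "dim_row X = N" "dim_col X = N" using assms by auto
  have "transpose_mat X = X \<longleftrightarrow> (\<forall>r\<in>{..<N}. \<forall>s\<in>{..<N}. X $$ (r, s) = X $$ (s, r))"
    using dim by (auto simp: mat_eq_iff)
  moreover have form: "v \<bullet> (X *\<^sub>v v) = bform {..<N} (\<lambda>r s. X $$ (r, s)) (($) v) (($) v)"
    if "v \<in> carrier_vec N" for v
    using that dim by (simp add: scalar_prod_def bform_def mat_app_def atLeast0LessThan)
  \<comment> \<open>Forms ignore values beyond \<open>N\<close>, so testing all functions is the
    same as testing all vectors of dimension \<open>N\<close>.\<close>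
  moreover have "bform {..<N} A f f = bform {..<N} A (($) (Matrix.vec N f)) (($) (Matrix.vec N f))" for A f
    by (simp add: bform_alt)
  ultimately show ?thesis
    unfolding pos_semidef_def psd_on_def using dim form
    by (auto simp: square_mat.simps) (metis vec_carrier)
qed

lemma sdp_feasible_iff:
  "sdp_feasible k N X \<longleftrightarrow> X \<in> carrier_mat N N \<and> (\<Sum>r<N. X $$ (r, r)) = real k \<and>
     (\<forall>r<N. (\<Sum>s<N. X $$ (r, s)) = 1) \<and> (\<forall>r<N. \<forall>s<N. 0 \<le> X $$ (r, s)) \<and>
     psd_on {..<N} (\<lambda>r s. X $$ (r, s))"
proof -
  have "X *\<^sub>v Matrix.vec N (\<lambda>_. 1) = Matrix.vec N (\<lambda>_. 1) \<longleftrightarrow> (\<forall>r<N. (\<Sum>s<N. X $$ (r, s)) = 1)"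
    if "X \<in> carrier_mat N N"
    using that by (auto simp: vec_eq_iff scalar_prod_def atLeast0LessThan)
  then show ?thesis
    unfolding sdp_feasible_def mat_trace_def using pos_semidef_iff by auto
qed

text \<open>The squared distance splits over coordinates, and each coordinate contributes the
  Dirichlet sum of \<open>doubly_stochastic_bform\<close>, which is twice the form of 1 - X.\<close>

lemma trace_sq_dist_matrix:
  assumes "sdp_feasible k (dim_col P) X"
  shows "mat_trace (sq_dist_matrix P * X) =
    2 * (\<Sum>j<dim_row P. bform {..<dim_col P} (compl_mat (\<lambda>r s. X $$ (r, s))) (\<lambda>r. P $$ (j, r)) (\<lambda>r. P $$ (j, r)))"
proof -
  let ?N = "dim_col P"
  have X: "X \<in> carrier_mat ?N ?N" and sym: "\<And>r s. r < ?N \<Longrightarrow> s < ?N \<Longrightarrow> X $$ (r, s) = X $$ (s, r)"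
    and row: "\<And>r. r < ?N \<Longrightarrow> (\<Sum>s<?N. X $$ (r, s)) = 1"
    using assms by (auto simp: sdp_feasible_iff psd_on_def)
  have "mat_trace (sq_dist_matrix P * X) =
      (\<Sum>r<?N. \<Sum>s<?N. (\<Sum>j<dim_row P. (P $$ (j, r) - P $$ (j, s))\<^sup>2) * X $$ (s, r))"
    using X by (simp add: mat_trace_def sq_dist_matrix_def scalar_prod_def atLeast0LessThan l2norm_sq)
  also have "\<dots> = (\<Sum>r<?N. \<Sum>s<?N. \<Sum>j<dim_row P. X $$ (r, s) * (P $$ (j, r) - P $$ (j, s))\<^sup>2)"
    using sym by (intro sum.cong refl) (simp add: sum_distrib_left mult.commute)
  also have "\<dots> = (\<Sum>r<?N. \<Sum>j<dim_row P. \<Sum>s<?N. X $$ (r, s) * (P $$ (j, r) - P $$ (j, s))\<^sup>2)"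
    by (rule sum.cong[OF refl]) (rule sum.swap)
  also have "\<dots> = (\<Sum>j<dim_row P. \<Sum>r<?N. \<Sum>s<?N. X $$ (r, s) * (P $$ (j, r) - P $$ (j, s))\<^sup>2)"
    by (rule sum.swap)
  also have "\<dots> = 2 * (\<Sum>j<dim_row P. bform {..<?N} (compl_mat (\<lambda>r s. X $$ (r, s))) (\<lambda>r. P $$ (j, r)) (\<lambda>r. P $$ (j, r)))"
    unfolding sum_distrib_left
  proof (rule sum.cong[OF refl])
    fix j
    show "(\<Sum>r<?N. \<Sum>s<?N. X $$ (r, s) * (P $$ (j, r) - P $$ (j, s))\<^sup>2) =
        2 * bform {..<?N} (compl_mat (\<lambda>r s. X $$ (r, s))) (\<lambda>r. P $$ (j, r)) (\<lambda>r. P $$ (j, r))"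
      by (subst doubly_stochastic_bform) (use sym row in auto)
  qed
  finally show ?thesis .
qed

section \<open>The block averaging matrix as a competitor\<close>

text \<open>The orthogonal projection onto vectors that are constant on each cluster, that is, the
  solution encoding the true clustering.\<close>

definition cluster_average :: "nat \<Rightarrow> nat \<Rightarrow> real mat" where
  "cluster_average k n = Matrix.mat (k * n) (k * n) (\<lambda>(r, s). of_bool (r div n = s div n) / real n)"

lemma bform_cluster_average:
  "bform {..<k * n} (\<lambda>r s. cluster_average k n $$ (r, s)) u v =
    (\<Sum>a<k. (\<Sum>i<n. u (a * n + i)) * (\<Sum>i<n. v (a * n + i))) / real n"
proof -
  have "bform {..<k * n} (\<lambda>r s. cluster_average k n $$ (r, s)) u v =
      (\<Sum>a<k. \<Sum>i<n. \<Sum>b<k. \<Sum>i'<n. u (a * n + i) * (of_bool (a = b) / real n) * v (b * n + i'))"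
    unfolding bform_alt sum_blocks by (intro sum.cong refl) (simp add: cluster_average_def block_index_less)
  also have "\<dots> = (\<Sum>a<k. \<Sum>i<n. \<Sum>b<k. if b = a then \<Sum>i'<n. u (a * n + i) / real n * v (a * n + i') else 0)"
    by (intro sum.cong refl) auto
  also have "\<dots> = (\<Sum>a<k. \<Sum>i<n. \<Sum>i'<n. u (a * n + i) / real n * v (a * n + i'))"
    by simp
  also have "\<dots> = (\<Sum>a<k. (\<Sum>i<n. u (a * n + i)) * (\<Sum>i<n. v (a * n + i))) / real n"
    by (simp add: sum_product sum_divide_distrib)
  finally show ?thesis .
qed

lemma cluster_average_feasible:
  assumes "n > 0"
  shows "sdp_feasible k (k * n) (cluster_average k n)"
proof -
  have row: "(\<Sum>s<k * n. cluster_average k n $$ (r, s)) = 1" if "r < k * n" for r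
  proof -
    have "(\<Sum>s<k * n. cluster_average k n $$ (r, s)) = (\<Sum>s<k * n. of_bool (r div n = s div n) / real n)"
      using that by (intro sum.cong refl) (simp add: cluster_average_def)
    also have "\<dots> = (\<Sum>a<k. \<Sum>i<n. of_bool (r div n = a) / real n)"
      unfolding sum_blocks by (intro sum.cong refl) simp
    also have "\<dots> = (\<Sum>a<k. if a = r div n then 1 else 0)"
      using assms by (intro sum.cong refl) auto
    also have "\<dots> = 1" using that assms by (simp add: less_mult_imp_div_less)
    finally show ?thesis .
  qed
  have "psd_on {..<k * n} (\<lambda>r s. cluster_average k n $$ (r, s))"
    unfolding psd_on_def bform_cluster_average
    by (auto simp: cluster_average_def intro!: divide_nonneg_nonneg sum_nonneg)
  then show ?thesis
    using row assms by (auto simp: sdp_feasible_iff cluster_average_def)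
qed

lemma data_matrix_entry:
  assumes "j < m" "a < k" "i < n"
  shows "data_matrix m k n \<omega> $$ (j, a * n + i) = \<omega> (a, i) j"
  using assms block_index_less[OF assms(2,3)] by (simp add: data_matrix_def)

lemma sum_centered_sq:
  fixes y :: "nat \<Rightarrow> real"
  assumes "n > 0"
  shows "(\<Sum>i<n. (y i - (\<Sum>l<n. y l) / real n)\<^sup>2) = (\<Sum>i<n. (y i)\<^sup>2) - (\<Sum>l<n. y l)\<^sup>2 / real n"
proof -
  have "(\<Sum>i<n. (y i - c)\<^sup>2) = (\<Sum>i<n. (y i)\<^sup>2) - 2 * c * (\<Sum>i<n. y i) + real n * c\<^sup>2" for c
    by (simp add: power2_diff sum.distrib sum_subtractf sum_distrib_left mult_ac)
  from this[of "(\<Sum>l<n. y l) / real n"] show ?thesis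
    using assms by (simp add: power2_eq_square)
qed

text \<open>The Gram matrix is \<open>s\<close> times the identity plus a matrix with entries at
  most \<open>d\<close>. The latter has norm at most \<open>m * d\<close>, hence at most
  \<open>s\<close>, and this doubles the leading term.\<close>

lemma empirical_second_moment_bound:
  fixes g :: "'r \<Rightarrow> nat \<Rightarrow> real"
  assumes G: "\<And>j l. j < m \<Longrightarrow> l < m \<Longrightarrow> \<bar>(\<Sum>r\<in>R. g r j * g r l) - s * of_bool (j = l)\<bar> \<le> d"
    and d: "real m * d \<le> s"
  shows "(\<Sum>r\<in>R. (\<Sum>j<m. g r j * v j)\<^sup>2) \<le> 2 * s * (\<Sum>j<m. (v j)\<^sup>2)"
proof (cases "m = 0")
  case True
  then show ?thesis by simp
next
  case False
  then have d0: "0 \<le> d" using G[of 0 0] by simp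
  define H where "H j l = (\<Sum>r\<in>R. g r j * g r l) - s * of_bool (j = l)" for j l
  have "(\<Sum>r\<in>R. (\<Sum>j<m. g r j * v j)\<^sup>2) = (\<Sum>r\<in>R. \<Sum>j<m. \<Sum>l<m. v j * v l * (g r j * g r l))"
    by (simp add: power2_eq_square sum_product mult_ac)
  also have "\<dots> = (\<Sum>j<m. \<Sum>r\<in>R. \<Sum>l<m. v j * v l * (g r j * g r l))"
    by (rule sum.swap)
  also have "\<dots> = (\<Sum>j<m. \<Sum>l<m. \<Sum>r\<in>R. v j * v l * (g r j * g r l))"
    by (intro sum.cong refl) (rule sum.swap)
  also have "\<dots> = (\<Sum>j<m. \<Sum>l<m. v j * v l * H j l + (if l = j then s * (v j)\<^sup>2 else 0))"
    unfolding sum_distrib_left[symmetric]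
    by (intro sum.cong refl) (auto simp: H_def algebra_simps power2_eq_square)
  also have "\<dots> = (\<Sum>j<m. \<Sum>l<m. v j * v l * H j l) + s * (\<Sum>j<m. (v j)\<^sup>2)"
    by (simp add: sum.distrib sum_distrib_left)
  also have "(\<Sum>j<m. \<Sum>l<m. v j * v l * H j l) \<le> (\<Sum>j<m. \<Sum>l<m. \<bar>v j\<bar> * \<bar>v l\<bar> * d)"
  proof (intro sum_mono)
    fix j l assume "j \<in> {..<m}" "l \<in> {..<m}"
    then have "\<bar>v j\<bar> * \<bar>v l\<bar> * \<bar>H j l\<bar> \<le> \<bar>v j\<bar> * \<bar>v l\<bar> * d"
      using G[of j l] by (intro mult_left_mono) (auto simp: H_def)
    then show "v j * v l * H j l \<le> \<bar>v j\<bar> * \<bar>v l\<bar> * d"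
      by (metis abs_le_D1 abs_mult)
  qed
  also have "(\<Sum>j<m. \<Sum>l<m. \<bar>v j\<bar> * \<bar>v l\<bar> * d) = (\<Sum>j<m. \<Sum>l<m. \<bar>v j\<bar> * \<bar>v l\<bar>) * d"
    by (simp only: sum_distrib_right)
  also have "(\<Sum>j<m. \<Sum>l<m. \<bar>v j\<bar> * \<bar>v l\<bar>) = (\<Sum>j<m. 1 * \<bar>v j\<bar>)\<^sup>2"
    by (simp only: power2_eq_square sum_product mult_1)
  \<comment> \<open>Cauchy-Schwarz against the all-ones vector; the factor \<open>m\<close> comes
    from its squared length.\<close>
  also have "(\<Sum>j<m. 1 * \<bar>v j\<bar>)\<^sup>2 * d \<le> ((\<Sum>j<m. 1\<^sup>2) * (\<Sum>j<m. \<bar>v j\<bar>\<^sup>2)) * d"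
    by (intro mult_right_mono Cauchy_Schwarz_ineq_sum d0)
  also have "\<dots> = (real m * d) * (\<Sum>j<m. (v j)\<^sup>2)" by simp
  also have "\<dots> \<le> s * (\<Sum>j<m. (v j)\<^sup>2)"
    by (intro mult_right_mono d sum_nonneg) auto
  finally show ?thesis by simp
qed

text \<open>Transfers \<open>sdp_error_bound\<close> to the program. Noise is measured from the
  empirical centroids, so averaging over clusters leaves exactly the noise energy as the
  competitor's value.\<close>

lemma sdp_minimizer_error:
  fixes P :: "real mat"
  assumes n: "n > 0" and P: "P \<in> carrier_mat m (k * n)"
    and min: "sdp_minimizer k (sq_dist_matrix P) X" and "0 \<le> B"
    and B: "\<And>v. (\<Sum>a<k. \<Sum>i<n. (\<Sum>j<m. (P $$ (j, a * n + i) - centroid n P a $ j) * v j)\<^sup>2)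
      \<le> B * (\<Sum>j<m. (v j)\<^sup>2)"
  shows "(\<Sum>a<k. \<Sum>i<n. (l2norm (col (P * X) (a * n + i) - centroid n P a))\<^sup>2) \<le> 14 * real k * B"
proof -
  let ?I = "{..<k * n}" and ?J = "{..<m}"
  have dim: "dim_row P = m" "dim_col P = k * n" using P by auto
  have feas: "sdp_feasible k (k * n) X"
    and opt: "\<And>Y. sdp_feasible k (k * n) Y \<Longrightarrow>
      mat_trace (sq_dist_matrix P * X) \<le> mat_trace (sq_dist_matrix P * Y)"
    using min dim by (auto simp: sdp_minimizer_def sq_dist_matrix_def)
  define X' where "X' = (\<lambda>r s. X $$ (r, s))"
  define Q where "Q = (\<lambda>r s. cluster_average k n $$ (r, s))"
  define \<mu> where "\<mu> r j = centroid n P (r div n) $ j" for r j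
  define \<rho> where "\<rho> r j = P $$ (j, r) - \<mu> r j" for r j
  have X: "X \<in> carrier_mat (k * n) (k * n)" "(\<Sum>r<k * n. X' r r) = real k" "psd_on ?I X'"
    "\<And>r. r < k * n \<Longrightarrow> (\<Sum>s<k * n. X' r s) = 1"
    "\<And>r s. r < k * n \<Longrightarrow> s < k * n \<Longrightarrow> 0 \<le> X' r s"
    using feas by (auto simp: sdp_feasible_iff X'_def)
  have sym: "X' r s = X' s r" if "r < k * n" "s < k * n" for r s
    using X(3) that by (auto simp: psd_on_def)
  have psdc: "psd_on ?I (compl_mat X')"
    using X sym by (intro doubly_stochastic_compl_psd) auto
  have cent: "centroid n P a $ j = (\<Sum>i<n. P $$ (j, a * n + i)) / real n" if "j < m" for a j
    using that dim by (simp add: centroid_def)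
  have mu: "\<mu> (a * n + i) j = centroid n P a $ j" if "i < n" for a i j
    using that by (simp add: \<mu>_def)
  have Q_form: "bform ?I (compl_mat Q) (\<lambda>r. P $$ (j, r)) (\<lambda>r. P $$ (j, r)) = (\<Sum>r<k * n. (\<rho> r j)\<^sup>2)"
    if "j < m" for j
  proof -
    have "bform ?I (compl_mat Q) (\<lambda>r. P $$ (j, r)) (\<lambda>r. P $$ (j, r)) =
        (\<Sum>a<k. (\<Sum>i<n. (P $$ (j, a * n + i))\<^sup>2) - (\<Sum>i<n. P $$ (j, a * n + i))\<^sup>2 / real n)"
      unfolding Q_def
      by (simp add: bform_compl bform_cluster_average sum_blocks sum_subtractf power2_eq_square sum_divide_distrib)
    also have "\<dots> = (\<Sum>r<k * n. (\<rho> r j)\<^sup>2)"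
      unfolding sum_blocks
      using that by (intro sum.cong refl) (simp add: \<rho>_def mu cent sum_centered_sq[OF n])
    finally show ?thesis .
  qed
  have "(\<Sum>j<m. bform ?I (compl_mat X') (\<lambda>r. P $$ (j, r)) (\<lambda>r. P $$ (j, r)))
      \<le> (\<Sum>j<m. bform ?I (compl_mat Q) (\<lambda>r. P $$ (j, r)) (\<lambda>r. P $$ (j, r)))"
    using opt[OF cluster_average_feasible[OF n]]
    unfolding trace_sq_dist_matrix[of k P, unfolded dim, OF feas]
      trace_sq_dist_matrix[of k P, unfolded dim, OF cluster_average_feasible[OF n]]
      X'_def Q_def by linarith
  then have opt': "(\<Sum>j<m. bform ?I (compl_mat X') (\<lambda>r. \<mu> r j + \<rho> r j) (\<lambda>r. \<mu> r j + \<rho> r j))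
      \<le> (\<Sum>j<m. \<Sum>r<k * n. (\<rho> r j)\<^sup>2)"
    by (simp add: Q_form \<rho>_def)
  have B': "(\<Sum>r<k * n. (\<Sum>j<m. \<rho> r j * v j)\<^sup>2) \<le> B * (\<Sum>j<m. (v j)\<^sup>2)" for v
    unfolding sum_blocks using B[of v] by (simp add: \<rho>_def mu)
  have cl: "r div n < k" if "r < k * n" for r
    using that by (simp add: less_mult_imp_div_less)
  have "(\<Sum>a<k. \<Sum>i<n. (l2norm (col (P * X) (a * n + i) - centroid n P a))\<^sup>2) =
      (\<Sum>r<k * n. \<Sum>j<m. (mat_app ?I X' (\<lambda>r. \<mu> r j + \<rho> r j) r - \<mu> r j)\<^sup>2)"
    unfolding sum_blocks
  proof (intro sum.cong refl)
    fix a i assume "a \<in> {..<k}" "i \<in> {..<n}"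
    then have r: "a * n + i < k * n" and i: "i < n" using block_index_less by auto
    \<comment> \<open>A column of the product runs along a column of \<open>X\<close>, whereas
      \<open>mat_app\<close> runs along a row; symmetry of \<open>X\<close> identifies them.\<close>
    have "col (P * X) (a * n + i) $ j = mat_app ?I X' (\<lambda>r. \<mu> r j + \<rho> r j) (a * n + i)" if "j < m" for j
      using that r dim X(1) sym[OF r]
      by (simp add: scalar_prod_def mat_app_def \<rho>_def atLeast0LessThan X'_def mult.commute)
    then show "(l2norm (col (P * X) (a * n + i) - centroid n P a))\<^sup>2 =
        (\<Sum>j<m. (mat_app ?I X' (\<lambda>r. \<mu> r j + \<rho> r j) (a * n + i) - \<mu> (a * n + i) j)\<^sup>2)"
      using dim i by (simp add: l2norm_sq centroid_def mu)
  qed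
  also have "\<dots> = (\<Sum>j<m. \<Sum>r<k * n. (mat_app ?I X' (\<lambda>r. \<mu> r j + \<rho> r j) r - \<mu> r j)\<^sup>2)"
    by (rule sum.swap)
  also have "\<dots> \<le> 14 * real k * B"
    by (rule sdp_error_bound[where cl = "\<lambda>r. r div n" and g = "\<lambda>a. ($) (centroid n P a)"])
      (use X psdc \<open>0 \<le> B\<close> B' cl opt' in \<open>auto simp: \<mu>_def\<close>)
  finally show ?thesis .
qed

section \<open>Separation of the centers and the spectral norm\<close>

lemma min_separation:
  assumes "2 \<le> k" "\<And>a. a < k \<Longrightarrow> \<gamma> a \<in> carrier_vec m" "inj_on \<gamma> {..<k}"
  shows "0 < min_separation k \<gamma>"
    and "\<And>a b. a < k \<Longrightarrow> b < k \<Longrightarrow> a \<noteq> b \<Longrightarrow> min_separation k \<gamma> \<le> l2norm (\<gamma> a - \<gamma> b)"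
proof -
  let ?S = "{l2norm (\<gamma> a - \<gamma> b) | a b. a < k \<and> b < k \<and> a \<noteq> b}"
  have "?S \<subseteq> (\<lambda>(a, b). l2norm (\<gamma> a - \<gamma> b)) ` ({..<k} \<times> {..<k})" by auto
  then have fin: "finite ?S" by (rule finite_subset) auto
  have "l2norm (\<gamma> 0 - \<gamma> 1) \<in> ?S" using assms(1) by fastforce
  then have ne: "?S \<noteq> {}" by blast
  have "0 < l2norm (\<gamma> a - \<gamma> b)" if "a < k" "b < k" "a \<noteq> b" for a b
  proof -
    have "\<gamma> a \<noteq> \<gamma> b" using assms(3) that by (auto simp: inj_on_def)
    then obtain j where "j < m" "\<gamma> a $ j \<noteq> \<gamma> b $ j"
      using assms(2)[OF \<open>a < k\<close>] assms(2)[OF \<open>b < k\<close>] by (metis carrier_vecD eq_vecI)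
    moreover have "dim_vec (\<gamma> a) = m" "dim_vec (\<gamma> b) = m" using assms(2) that by auto
    ultimately have "0 < (l2norm (\<gamma> a - \<gamma> b))\<^sup>2"
      unfolding l2norm_sq by (intro sum_pos2[of _ j]) auto
    then show ?thesis using l2norm_nonneg[of "\<gamma> a - \<gamma> b"] by (cases "l2norm (\<gamma> a - \<gamma> b) = 0") auto
  qed
  then show "0 < min_separation k \<gamma>"
    unfolding min_separation_def using fin ne by (subst Min_gr_iff) auto
  show "min_separation k \<gamma> \<le> l2norm (\<gamma> a - \<gamma> b)" if "a < k" "b < k" "a \<noteq> b" for a b
    unfolding min_separation_def using fin that by (intro Min_le) auto
qed

text \<open>The test vector with entry 1/2 at \<open>a\<close> and -1/2 at \<open>b\<close> is
  mapped to half the difference of the two centroids, since the subtracted mean cancels.\<close>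

lemma centroid_separation_le_spectral_norm:
  assumes "P \<in> carrier_mat m N" "a < k" "b < k" "a \<noteq> b"
  shows "l2norm (centroid n P a - centroid n P b) \<le> 2 * spectral_norm (centered_centroids k n P)"
proof -
  let ?A = "centered_centroids k n P"
  define v :: "real Matrix.vec" where "v = Matrix.vec k (\<lambda>t. (of_bool (t = a) - of_bool (t = b)) / 2)"
  have dimA: "dim_row ?A = m" "dim_col ?A = k" using assms(1) by (auto simp: centered_centroids_def)
  have sumv: "(\<Sum>t<k. f t * (v $ t)) = (f a - f b) / 2" for f
  proof -
    have "(\<Sum>t<k. f t * (v $ t)) = (\<Sum>t<k. (if t = a then f t / 2 else 0) - (if t = b then f t / 2 else 0))"
      by (intro sum.cong refl) (auto simp: v_def field_simps)
    then show ?thesis using assms by (simp add: sum_subtractf diff_divide_distrib)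
  qed
  \<comment> \<open>Writing the square as a product lets \<open>sumv\<close> be applied to
    \<open>v\<close> itself.\<close>
  have "(l2norm v)\<^sup>2 = (\<Sum>t<k. v $ t * (v $ t))" by (simp add: l2norm_sq v_def) (simp add: power2_eq_square)
  also have "\<dots> = 1 / 2" unfolding sumv using assms by (simp add: v_def)
  finally have "l2norm v \<le> 1" using power2_le_imp_le[of "l2norm v" 1] by simp
  then have le: "l2norm (?A *\<^sub>v v) \<le> spectral_norm ?A"
    by (intro l2norm_mult_vec_le_spectral_norm) (auto simp: dimA v_def)
  have comp: "(centroid n P a - centroid n P b) $ j = 2 * (?A *\<^sub>v v) $ j" if "j < m" for j
  proof -
    have "(?A *\<^sub>v v) $ j = (\<Sum>t<k. ?A $$ (j, t) * (v $ t))"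
      using that dimA by (simp add: scalar_prod_def atLeast0LessThan v_def)
    also have "\<dots> = (?A $$ (j, a) - ?A $$ (j, b)) / 2" by (rule sumv)
    finally show ?thesis using that assms by (simp add: centered_centroids_def centroid_def)
  qed
  have "(l2norm (centroid n P a - centroid n P b))\<^sup>2 = (\<Sum>j<m. ((centroid n P a - centroid n P b) $ j)\<^sup>2)"
    using assms(1) by (simp add: l2norm_sq centroid_def)
  also have "\<dots> = (\<Sum>j<m. (2 * (?A *\<^sub>v v) $ j)\<^sup>2)"
    by (rule sum.cong[OF refl]) (simp only: comp lessThan_iff)
  also have "\<dots> = (2 * l2norm (?A *\<^sub>v v))\<^sup>2"
    using dimA by (simp add: l2norm_sq power_mult_distrib sum_distrib_left)
  finally have "(l2norm (centroid n P a - centroid n P b))\<^sup>2 = (2 * l2norm (?A *\<^sub>v v))\<^sup>2" .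
  then have "l2norm (centroid n P a - centroid n P b) = 2 * l2norm (?A *\<^sub>v v)"
    by (rule power2_eq_imp_eq) (auto simp: l2norm_nonneg)
  then show ?thesis using le by simp
qed

subsection \<open>Concentration of the sample\<close>

text \<open>Chebyshev's inequality for a sum of independent centered variables: the mixed second
  moments factor and vanish, so at most \<open>card I * B\<close> remains.\<close>

lemma PiM_second_moment_tail:
  fixes f :: "'i \<Rightarrow> 'a \<Rightarrow> real"
  assumes fin: "finite I" and P: "\<And>i. prob_space (M i)"
    and f: "\<And>i. i \<in> I \<Longrightarrow> f i \<in> borel_measurable (M i)"
    and sq: "\<And>i. i \<in> I \<Longrightarrow> integrable (M i) (\<lambda>x. (f i x)\<^sup>2)"
    and mean: "\<And>i. i \<in> I \<Longrightarrow> integral\<^sup>L (M i) (f i) = 0"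
    and B: "\<And>i. i \<in> I \<Longrightarrow> integral\<^sup>L (M i) (\<lambda>x. (f i x)\<^sup>2) \<le> B"
    and "0 < e"
  shows "measure (PiM I M) {\<omega> \<in> space (PiM I M). e \<le> \<bar>\<Sum>i\<in>I. f i (\<omega> i)\<bar>} \<le> real (card I) * B / e\<^sup>2"
proof -
  interpret product_prob_space M I
    by (intro product_prob_space.intro product_sigma_finite.intro product_prob_space_axioms.intro
        prob_space_imp_sigma_finite P)
  note [measurable] = f
  have f_int: "integrable (M i) (f i)" if "i \<in> I" for i
    by (rule M.square_integrable_imp_integrable[OF f[OF that] sq[OF that]])
  \<comment> \<open>The product of two coordinate functions is written as a product over all
    coordinates, to which the product formula for integrals applies. For \<open>i = j\<close> the
    single nontrivial factor is the square.\<close>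
  define g where "g i j l x = (if l = i then f i x else 1) * (if l = j then f j x else 1)" for i j l x
  have g_int: "integrable (M l) (g i j l)" if "i \<in> I" "j \<in> I" for i j l
    using that f_int[of l] sq[of l] unfolding g_def[abs_def]
    by (cases "l = i"; cases "l = j") (auto simp: power2_eq_square)
  have g_prod: "(\<Prod>l\<in>I. g i j l (\<omega> l)) = f i (\<omega> i) * f j (\<omega> j)" if "i \<in> I" "j \<in> I" for i j \<omega>
    unfolding g_def prod.distrib using fin that
    by (simp add: prod.delta')
  have int: "integrable (PiM I M) (\<lambda>\<omega>. f i (\<omega> i) * f j (\<omega> j))" if "i \<in> I" "j \<in> I" for i j
    using product_integrable_prod[OF fin, of "g i j"] g_int[OF that] g_prod[OF that] by simp
  have val: "(\<integral>\<omega>. f i (\<omega> i) * f j (\<omega> j) \<partial>PiM I M) \<le> (if i = j then B else 0)"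
    if "i \<in> I" "j \<in> I" for i j
  proof -
    have "(\<integral>\<omega>. f i (\<omega> i) * f j (\<omega> j) \<partial>PiM I M) = (\<Prod>l\<in>I. integral\<^sup>L (M l) (g i j l))"
      using product_integral_prod[OF fin, of "g i j"] g_int[OF that] g_prod[OF that] by simp
    also have "\<dots> \<le> (if i = j then B else 0)"
    proof (cases "i = j")
      case True
      have "(\<Prod>l\<in>I. integral\<^sup>L (M l) (g i j l)) =
          (\<Prod>l\<in>I. if l = i then integral\<^sup>L (M i) (\<lambda>x. (f i x)\<^sup>2) else 1)"
        using True by (intro prod.cong refl) (auto simp: g_def[abs_def] power2_eq_square M.prob_space)
      then show ?thesis using True that fin B by (simp add: prod.delta')
    next
      case False
      have "integral\<^sup>L (M i) (g i j i) = 0"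
        using False mean[OF that(1)] by (simp add: g_def[abs_def])
      then show ?thesis using False that fin by (simp add: prod_zero_iff) (metis prod_zero order_refl)
    qed
    finally show ?thesis .
  qed
  have expand: "(\<Sum>i\<in>I. f i (\<omega> i))\<^sup>2 = (\<Sum>i\<in>I. \<Sum>j\<in>I. f i (\<omega> i) * f j (\<omega> j))" for \<omega>
    by (simp add: power2_eq_square sum_product)
  have sm: "(\<integral>\<omega>. (\<Sum>i\<in>I. f i (\<omega> i))\<^sup>2 \<partial>PiM I M) \<le> real (card I) * B"
  proof -
    have "(\<integral>\<omega>. (\<Sum>i\<in>I. f i (\<omega> i))\<^sup>2 \<partial>PiM I M) =
        (\<Sum>i\<in>I. \<Sum>j\<in>I. \<integral>\<omega>. f i (\<omega> i) * f j (\<omega> j) \<partial>PiM I M)"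
      unfolding expand using int by (simp add: Bochner_Integration.integral_sum Bochner_Integration.integrable_sum)
    also have "\<dots> \<le> (\<Sum>i\<in>I. \<Sum>j\<in>I. if i = j then B else 0)"
      by (intro sum_mono val)
    also have "\<dots> = real (card I) * B" using fin by simp
    finally show ?thesis .
  qed
  have "measure (PiM I M) {\<omega> \<in> space (PiM I M). e \<le> \<bar>\<Sum>i\<in>I. f i (\<omega> i)\<bar>}
      \<le> (\<integral>\<omega>. (\<Sum>i\<in>I. f i (\<omega> i))\<^sup>2 \<partial>PiM I M) / e\<^sup>2"
  proof (rule P.second_moment_method)
    show "integrable (PiM I M) (\<lambda>\<omega>. (\<Sum>i\<in>I. f i (\<omega> i))\<^sup>2)"
      unfolding expand using int by (intro Bochner_Integration.integrable_sum) auto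
  qed (use \<open>0 < e\<close> in measurable)
  also have "\<dots> \<le> real (card I) * B / e\<^sup>2"
    using sm by (intro divide_right_mono) auto
  finally show ?thesis .
qed

text \<open>Chebyshev at level \<open>n * e\<close> bounds each failure probability by a constant
  over \<open>n\<close>, since there are \<open>k * n\<close> terms; a union bound covers the finite
  family. Each function takes the cluster as an argument because the clusters have different
  laws.\<close>

lemma weak_law_clusters:
  fixes F :: "(nat \<Rightarrow> 'a \<Rightarrow> real) set" and \<nu> :: "nat \<Rightarrow> 'a measure"
  assumes P: "\<And>a. prob_space (\<nu> a)" and F: "finite F"
    and f: "\<And>f a. f \<in> F \<Longrightarrow> a < k \<Longrightarrow> f a \<in> borel_measurable (\<nu> a)"
    and sq: "\<And>f a. f \<in> F \<Longrightarrow> a < k \<Longrightarrow> integrable (\<nu> a) (\<lambda>x. (f a x)\<^sup>2)"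
    and mean: "\<And>f a. f \<in> F \<Longrightarrow> a < k \<Longrightarrow> integral\<^sup>L (\<nu> a) (f a) = 0"
    and e: "0 < e"
  defines "M \<equiv> \<lambda>n. PiM ({..<k} \<times> {..<n}) (\<lambda>(a, i). \<nu> a)"
  defines "E \<equiv> \<lambda>n. {\<omega> \<in> space (M n). \<forall>f\<in>F. \<bar>\<Sum>(a, i)\<in>{..<k} \<times> {..<n}. f a (\<omega> (a, i))\<bar> < real n * e}"
  shows "E n \<in> sets (M n)" and "(\<lambda>n. measure (M n) (E n)) \<longlonglongrightarrow> 1"
proof -
  have PM: "prob_space (M n)" for n
    unfolding M_def by (intro prob_space_PiM) (auto simp: P)
  define S where "S f n \<omega> = (\<Sum>r\<in>{..<k} \<times> {..<n}. (case r of (a, i) \<Rightarrow> f a) (\<omega> r))"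
    for f :: "nat \<Rightarrow> 'a \<Rightarrow> real" and n :: nat and \<omega>
  have S_eq: "S f n \<omega> = (\<Sum>(a, i)\<in>{..<k} \<times> {..<n}. f a (\<omega> (a, i)))" for f n \<omega>
    unfolding S_def by (intro sum.cong refl) auto
  have S_meas [measurable]: "S f n \<in> borel_measurable (M n)" if "f \<in> F" for f n
  proof -
    have "(\<lambda>\<omega>. (case r of (a, i) \<Rightarrow> f a) (\<omega> r)) \<in> borel_measurable (M n)"
      if "r \<in> {..<k} \<times> {..<n}" for r
    proof -
      have "(\<lambda>\<omega>. \<omega> r) \<in> measurable (M n) (case r of (a, i) \<Rightarrow> \<nu> a)"
        unfolding M_def using that by (rule measurable_component_singleton)
      moreover have "(case r of (a, i) \<Rightarrow> f a) \<in> borel_measurable (case r of (a, i) \<Rightarrow> \<nu> a)"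
        using that f[OF \<open>f \<in> F\<close>] by auto
      ultimately show ?thesis by (rule measurable_compose)
    qed
    then show ?thesis unfolding S_def[abs_def] by (rule borel_measurable_sum)
  qed
  have E_alt: "E n = {\<omega> \<in> space (M n). \<forall>f\<in>F. \<bar>S f n \<omega>\<bar> < real n * e}" for n
    by (simp add: E_def S_eq)
  have E_sets: "E n \<in> sets (M n)" for n
  proof -
    have "{\<omega> \<in> space (M n). \<bar>S f n \<omega>\<bar> < real n * e} \<in> sets (M n)" if "f \<in> F" for f
      using S_meas[OF that] by measurable
    then show ?thesis unfolding E_alt using F by (intro sets.sets_Collect_finite_All)
  qed
  then show "E n \<in> sets (M n)" .
  \<comment> \<open>A crude uniform bound: the sum of all second moments that occur.\<close>
  define B where "B = (\<Sum>f\<in>F. \<Sum>a<k. integral\<^sup>L (\<nu> a) (\<lambda>x. (f a x)\<^sup>2))"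
  have B: "integral\<^sup>L (\<nu> a) (\<lambda>x. (f a x)\<^sup>2) \<le> B" if "f \<in> F" "a < k" for f a
  proof -
    have "integral\<^sup>L (\<nu> a) (\<lambda>x. (f a x)\<^sup>2) \<le> (\<Sum>a<k. integral\<^sup>L (\<nu> a) (\<lambda>x. (f a x)\<^sup>2))"
      using that by (intro member_le_sum) auto
    also have "\<dots> \<le> B"
      unfolding B_def using that F
      by (intro member_le_sum[of f F "\<lambda>f. \<Sum>a<k. integral\<^sup>L (\<nu> a) (\<lambda>x. (f a x)\<^sup>2)"])
        (auto intro!: sum_nonneg)
    finally show ?thesis .
  qed
  define K where "K = real (card F) * (real k * B / e\<^sup>2)"
  have lower: "1 - K / real n \<le> measure (M n) (E n)" if "n > 0" for n
  proof -
    interpret prob_space "M n" by (rule PM)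
    let ?T = "\<lambda>f. {\<omega> \<in> space (M n). real n * e \<le> \<bar>S f n \<omega>\<bar>}"
    have T: "?T f \<in> sets (M n)" if "f \<in> F" for f
      using S_meas[OF that] by measurable
    have "measure (M n) (?T f) \<le> real (card ({..<k} \<times> {..<n})) * B / (real n * e)\<^sup>2" if "f \<in> F" for f
      unfolding S_def M_def
      by (intro PiM_second_moment_tail) (use that \<open>n > 0\<close> e in \<open>auto simp: P f sq mean B\<close>)
    also have "real (card ({..<k} \<times> {..<n})) * B / (real n * e)\<^sup>2 = real k * B / e\<^sup>2 / real n"
      using \<open>n > 0\<close> by (simp add: card_cartesian_product power2_eq_square field_simps)
    finally have T_le: "measure (M n) (?T f) \<le> real k * B / e\<^sup>2 / real n" if "f \<in> F" for f
      using that by blast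
    have "measure (M n) (space (M n) - E n) \<le> measure (M n) (\<Union>f\<in>F. ?T f)"
      using T F by (intro finite_measure_mono) (auto simp: E_alt not_less)
    also have "\<dots> \<le> (\<Sum>f\<in>F. measure (M n) (?T f))"
      using T F by (intro finite_measure_subadditive_finite) auto
    also have "\<dots> \<le> (\<Sum>f\<in>F. real k * B / e\<^sup>2 / real n)"
      by (intro sum_mono T_le)
    also have "\<dots> = K / real n" by (simp add: K_def)
    finally show ?thesis
      using prob_compl[OF E_sets[of n]] by simp
  qed
  show "(\<lambda>n. measure (M n) (E n)) \<longlonglongrightarrow> 1"
  proof (rule tendsto_sandwich)
    show "eventually (\<lambda>n. 1 - K / real n \<le> measure (M n) (E n)) sequentially"
      using eventually_gt_at_top[of 0] by eventually_elim (rule lower)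
    show "eventually (\<lambda>n. measure (M n) (E n) \<le> 1) sequentially"
      using PM by (intro always_eventually allI prob_space.prob_le_1)
    have "(\<lambda>n. K / real n) \<longlonglongrightarrow> 0" by (rule lim_const_over_n)
    from tendsto_diff[OF tendsto_const[of 1] this]
    show "(\<lambda>n. 1 - K / real n) \<longlonglongrightarrow> 1" by simp
  qed auto
qed

section \<open>Moments of the Gaussian sample\<close>

lemma prob_space_spherical_gaussian:
  assumes "\<sigma> > 0"
  shows "prob_space (spherical_gaussian \<mu> \<sigma>)"
  unfolding spherical_gaussian_def
  by (intro prob_space_PiM prob_space_normal_density assms)

lemma normal_density_moments:
  fixes \<mu> \<sigma> :: real
  assumes "\<sigma> > 0"
  defines "N \<equiv> density lborel (\<lambda>t. ennreal (normal_density \<mu> \<sigma> t))"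
  shows "integrable N (\<lambda>t. (t - \<mu>) ^ p)"
    and "integral\<^sup>L N (\<lambda>t. t - \<mu>) = 0"
    and "integral\<^sup>L N (\<lambda>t. (t - \<mu>)\<^sup>2) = \<sigma>\<^sup>2"
    and "measure N UNIV = 1"
proof -
  show "integrable N (\<lambda>t. (t - \<mu>) ^ p)"
    unfolding N_def using integrable_normal_moment[OF assms(1), of \<mu> p]
    by (subst integrable_density) auto
  show "integral\<^sup>L N (\<lambda>t. t - \<mu>) = 0"
    unfolding N_def using integral_normal_moment_odd[OF assms(1), of \<mu> 0]
    by (subst integral_density) auto
  show "integral\<^sup>L N (\<lambda>t. (t - \<mu>)\<^sup>2) = \<sigma>\<^sup>2"
    unfolding N_def using integral_normal_moment_even[OF assms(1), of \<mu> 1]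
    by (subst integral_density) auto
  show "measure N UNIV = 1"
    using prob_space.prob_space[OF prob_space_normal_density[OF assms(1), of \<mu>]] by (simp add: N_def)
qed

lemma spherical_gaussian_product_moment:
  assumes "\<sigma> > 0"
  shows "integrable (spherical_gaussian \<mu> \<sigma>) (\<lambda>x. \<Prod>j<dim_vec \<mu>. (x j - \<mu> $ j) ^ p j)"
    and "integral\<^sup>L (spherical_gaussian \<mu> \<sigma>) (\<lambda>x. \<Prod>j<dim_vec \<mu>. (x j - \<mu> $ j) ^ p j) =
      (\<Prod>j<dim_vec \<mu>. integral\<^sup>L (density lborel (\<lambda>t. ennreal (normal_density (\<mu> $ j) \<sigma> t))) (\<lambda>t. (t - \<mu> $ j) ^ p j))"
proof -
  interpret product_sigma_finite "\<lambda>j. density lborel (\<lambda>t. ennreal (normal_density (\<mu> $ j) \<sigma> t))"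
    by (intro product_sigma_finite.intro prob_space_imp_sigma_finite prob_space_normal_density assms)
  show "integrable (spherical_gaussian \<mu> \<sigma>) (\<lambda>x. \<Prod>j<dim_vec \<mu>. (x j - \<mu> $ j) ^ p j)"
    unfolding spherical_gaussian_def
    by (intro product_integrable_prod normal_density_moments assms) auto
  show "integral\<^sup>L (spherical_gaussian \<mu> \<sigma>) (\<lambda>x. \<Prod>j<dim_vec \<mu>. (x j - \<mu> $ j) ^ p j) =
      (\<Prod>j<dim_vec \<mu>. integral\<^sup>L (density lborel (\<lambda>t. ennreal (normal_density (\<mu> $ j) \<sigma> t))) (\<lambda>t. (t - \<mu> $ j) ^ p j))"
    unfolding spherical_gaussian_def
    by (rule product_integral_prod) (auto intro: normal_density_moments assms)
qed

text \<open>Encodes a monomial in two coordinates as a product over all of them. Adding the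
  exponents handles \<open>j = l\<close> and \<open>j \<noteq> l\<close> together.\<close>

lemma prod_two_powers:
  fixes y :: "nat \<Rightarrow> real"
  assumes "j < m" "l < m"
  shows "(\<Prod>t<m. y t ^ ((if t = j then p else 0) + (if t = l then q else 0))) = y j ^ p * y l ^ q"
proof -
  have "(\<Prod>t<m. y t ^ ((if t = j then p else 0) + (if t = l then q else 0))) =
      (\<Prod>t<m. (if t = j then y j ^ p else 1) * (if t = l then y l ^ q else 1))"
    by (intro prod.cong refl) (auto simp: power_add)
  then show ?thesis using assms by (simp add: prod.distrib)
qed

lemma spherical_gaussian_moments:
  fixes \<mu> :: "real Matrix.vec"
  assumes "\<sigma> > 0" "j < dim_vec \<mu>" "l < dim_vec \<mu>"
  shows "integrable (spherical_gaussian \<mu> \<sigma>) (\<lambda>x. (x j - \<mu> $ j) ^ p * (x l - \<mu> $ l) ^ q)"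
    and "integral\<^sup>L (spherical_gaussian \<mu> \<sigma>) (\<lambda>x. x j - \<mu> $ j) = 0"
    and "integral\<^sup>L (spherical_gaussian \<mu> \<sigma>) (\<lambda>x. (x j - \<mu> $ j) * (x l - \<mu> $ l)) = \<sigma>\<^sup>2 * of_bool (j = l)"
proof -
  let ?N = "\<lambda>t. density lborel (\<lambda>s. ennreal (normal_density (\<mu> $ t) \<sigma> s))"
  define e where "e p q t = (if t = j then p else 0) + (if t = l then q else 0 :: nat)" for p q t
  have pr: "(\<Prod>t<dim_vec \<mu>. (x t - \<mu> $ t) ^ e p q t) = (x j - \<mu> $ j) ^ p * (x l - \<mu> $ l) ^ q" for p q x
    unfolding e_def using prod_two_powers[OF assms(2,3), of "\<lambda>t. x t - \<mu> $ t"] .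
  note mom = spherical_gaussian_product_moment[OF assms(1), of \<mu> "e _ _", unfolded pr]
  note N = normal_density_moments[OF assms(1)]
  show "integrable (spherical_gaussian \<mu> \<sigma>) (\<lambda>x. (x j - \<mu> $ j) ^ p * (x l - \<mu> $ l) ^ q)"
    by (rule mom)
  have "(\<Prod>t<dim_vec \<mu>. integral\<^sup>L (?N t) (\<lambda>s. (s - \<mu> $ t) ^ e 1 0 t)) = 0"
    using assms(2) N(2) by (intro prod_zero bexI[of _ j]) (auto simp: e_def)
  then show "integral\<^sup>L (spherical_gaussian \<mu> \<sigma>) (\<lambda>x. x j - \<mu> $ j) = 0"
    using mom(2)[of 1 0] by simp
  show "integral\<^sup>L (spherical_gaussian \<mu> \<sigma>) (\<lambda>x. (x j - \<mu> $ j) * (x l - \<mu> $ l)) = \<sigma>\<^sup>2 * of_bool (j = l)"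
  proof (cases "j = l")
    case True
    have "(\<Prod>t<dim_vec \<mu>. integral\<^sup>L (?N t) (\<lambda>s. (s - \<mu> $ t) ^ e 1 1 t)) =
        (\<Prod>t<dim_vec \<mu>. if t = j then \<sigma>\<^sup>2 else 1)"
      using True N(3,4) by (intro prod.cong refl) (auto simp: e_def numeral_2_eq_2[symmetric])
    then show ?thesis using mom(2)[of 1 1] True assms by simp
  next
    case False
    have "(\<Prod>t<dim_vec \<mu>. integral\<^sup>L (?N t) (\<lambda>s. (s - \<mu> $ t) ^ e 1 1 t)) = 0"
      using assms(2) N(2) False by (intro prod_zero bexI[of _ j]) (auto simp: e_def)
    then show ?thesis using mom(2)[of 1 1] False by simp
  qed
qed

lemma spherical_gaussian_component_measurable:
  fixes \<mu> :: "real Matrix.vec"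
  assumes "j < dim_vec \<mu>"
  shows "(\<lambda>x. x j) \<in> borel_measurable (spherical_gaussian \<mu> \<sigma>)"
proof -
  have "(\<lambda>x. x j) \<in> measurable (spherical_gaussian \<mu> \<sigma>) (density lborel (\<lambda>t. ennreal (normal_density (\<mu> $ j) \<sigma> t)))"
    unfolding spherical_gaussian_def using assms by (intro measurable_component_singleton) auto
  then show ?thesis by simp
qed

text \<open>One event controls all cluster means and all entries of the empirical second moment
  matrix, by applying the weak law to a finite family of linear and quadratic functions.\<close>

lemma mixture_concentration:
  fixes \<gamma> :: "nat \<Rightarrow> real Matrix.vec"
  assumes \<sigma>: "\<sigma> > 0" and \<gamma>: "\<And>a. a < k \<Longrightarrow> \<gamma> a \<in> carrier_vec m" and e: "0 < e"
  obtains E where "\<And>n. E n \<in> sets (mixture_sample k n \<gamma> \<sigma>)"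
    and "(\<lambda>n. measure (mixture_sample k n \<gamma> \<sigma>) (E n)) \<longlonglongrightarrow> 1"
    and "\<And>n \<omega> a j. \<omega> \<in> E n \<Longrightarrow> a < k \<Longrightarrow> j < m \<Longrightarrow> \<bar>\<Sum>i<n. \<omega> (a, i) j - \<gamma> a $ j\<bar> < real n * e"
    and "\<And>n \<omega> j l. \<omega> \<in> E n \<Longrightarrow> j < m \<Longrightarrow> l < m \<Longrightarrow>
      \<bar>(\<Sum>a<k. \<Sum>i<n. (\<omega> (a, i) j - \<gamma> a $ j) * (\<omega> (a, i) l - \<gamma> a $ l))
         - real (k * n) * (\<sigma>\<^sup>2 * of_bool (j = l))\<bar> < real n * e"
proof -
  \<comment> \<open>The factor \<open>of_bool (b = a)\<close> restricts the sum over all points to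
    cluster \<open>a\<close>; \<open>f2\<close> is a product of noise coordinates minus its
    mean.\<close>
  define f1 where "f1 a j = (\<lambda>b (x :: nat \<Rightarrow> real). of_bool (b = a) * (x j - \<gamma> b $ j))" for a j :: nat
  define f2 where "f2 j l = (\<lambda>b (x :: nat \<Rightarrow> real).
    (x j - \<gamma> b $ j) * (x l - \<gamma> b $ l) - \<sigma>\<^sup>2 * of_bool (j = l))" for j l :: nat
  define F where "F = (\<lambda>(a, j). f1 a j) ` ({..<k} \<times> {..<m}) \<union> (\<lambda>(j, l). f2 j l) ` ({..<m} \<times> {..<m})"
  have dim: "dim_vec (\<gamma> a) = m" if "a < k" for a using \<gamma>[OF that] by auto
  have F_cases [consumes 1, case_names lin quad]: "P" if "h \<in> F"
    "\<And>a j. a < k \<Longrightarrow> j < m \<Longrightarrow> h = f1 a j \<Longrightarrow> P" "\<And>j l. j < m \<Longrightarrow> l < m \<Longrightarrow> h = f2 j l \<Longrightarrow> P" for h P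
    using that by (auto simp: F_def)
  let ?G = "\<lambda>b. spherical_gaussian (\<gamma> b) \<sigma>"
  have comp: "(\<lambda>x. x j) \<in> borel_measurable (?G b)" if "b < k" "j < m" for b j
    using spherical_gaussian_component_measurable dim that by simp
  note mom = spherical_gaussian_moments[OF \<sigma>]
  have int1: "integrable (?G b) (\<lambda>x. (x j - \<gamma> b $ j) ^ p * (x l - \<gamma> b $ l) ^ q)"
    if "b < k" "j < m" "l < m" for b j l p q
    using mom(1) dim that by simp
  have cst: "integrable (?G b) (\<lambda>x. c)" for b and c :: real
    using prob_space_spherical_gaussian[OF \<sigma>, of "\<gamma> b"]
    by (simp add: prob_space.finite_measure finite_measure.integrable_const)
  have m1: "h b \<in> borel_measurable (?G b)" if "h \<in> F" "b < k" for h b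
    using that(1)
  proof (cases rule: F_cases)
    case (lin a j)
    note [measurable] = comp[OF that(2) lin(2)]
    show ?thesis unfolding lin f1_def by measurable
  next
    case (quad j l)
    note [measurable] = comp[OF that(2) quad(1)] comp[OF that(2) quad(2)]
    show ?thesis unfolding quad f2_def by measurable
  qed
  have m2: "integrable (?G b) (\<lambda>x. (h b x)\<^sup>2)" if "h \<in> F" "b < k" for h b
    using that(1)
  proof (cases rule: F_cases)
    case (lin a j)
    show ?thesis using int1[OF that(2) lin(2) lin(2), of 2 0] by (auto simp: lin f1_def power_mult_distrib)
  next
    case (quad j l)
    \<comment> \<open>The square of \<open>f2\<close> is expanded into moments of exponents (2,2)
      and (1,1) and a constant.\<close>
    have "integrable (?G b) (\<lambda>x. (x j - \<gamma> b $ j)\<^sup>2 * (x l - \<gamma> b $ l)\<^sup>2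
      - 2 * (\<sigma>\<^sup>2 * of_bool (j = l)) * ((x j - \<gamma> b $ j) ^ 1 * (x l - \<gamma> b $ l) ^ 1) + (\<sigma>\<^sup>2 * of_bool (j = l))\<^sup>2)"
      using int1[OF that(2) quad(1,2), of 2 2] int1[OF that(2) quad(1,2), of 1 1] cst
      by (intro Bochner_Integration.integrable_add Bochner_Integration.integrable_diff integrable_mult_right) auto
    moreover have "(p * q - c)\<^sup>2 = p\<^sup>2 * q\<^sup>2 - 2 * c * (p ^ 1 * q ^ 1) + c\<^sup>2" for p q c :: real
      by (simp add: power2_eq_square algebra_simps)
    ultimately show ?thesis
      unfolding quad f2_def by presburger
  qed
  have m3: "integral\<^sup>L (?G b) (h b) = 0" if "h \<in> F" "b < k" for h b
    using that(1)
  proof (cases rule: F_cases)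
    case (lin a j)
    show ?thesis using mom(2)[of j "\<gamma> b" j] dim[OF that(2)] lin(2) by (simp add: lin f1_def)
  next
    case (quad j l)
    have "integral\<^sup>L (?G b) (f2 j l b) =
        integral\<^sup>L (?G b) (\<lambda>x. (x j - \<gamma> b $ j) * (x l - \<gamma> b $ l)) - integral\<^sup>L (?G b) (\<lambda>x. \<sigma>\<^sup>2 * of_bool (j = l))"
      unfolding f2_def using int1[OF that(2) quad(1,2), of 1 1] cst
      by (intro Bochner_Integration.integral_diff) auto
    also have "\<dots> = 0"
      using mom(3)[of j "\<gamma> b" l] dim[OF that(2)] quad
        prob_space.prob_space[OF prob_space_spherical_gaussian[OF \<sigma>, of "\<gamma> b"]] by simp
    finally show ?thesis by (simp add: quad)
  qed
  have finF: "finite F" by (simp add: F_def)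
  define E where "E n = {\<omega> \<in> space (mixture_sample k n \<gamma> \<sigma>).
    \<forall>f\<in>F. \<bar>\<Sum>(a, i)\<in>{..<k} \<times> {..<n}. f a (\<omega> (a, i))\<bar> < real n * e}" for n
  have pG: "prob_space (?G b)" for b
    by (rule prob_space_spherical_gaussian[OF \<sigma>])
  have wl: "E n \<in> sets (mixture_sample k n \<gamma> \<sigma>)" "(\<lambda>n. measure (mixture_sample k n \<gamma> \<sigma>) (E n)) \<longlonglongrightarrow> 1" for n
    unfolding E_def mixture_sample_def
    by (rule weak_law_clusters[where \<nu> = ?G]; fact pG finF m1 m2 m3 e)+
  have 1: "\<bar>\<Sum>i<n. \<omega> (a, i) j - \<gamma> a $ j\<bar> < real n * e" if "\<omega> \<in> E n" "a < k" "j < m" for \<omega> n a j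
  proof -
    have "f1 a j \<in> F" using that unfolding F_def by force
    then have "\<bar>\<Sum>(b, i)\<in>{..<k} \<times> {..<n}. f1 a j b (\<omega> (b, i))\<bar> < real n * e"
      using that(1) by (auto simp: E_def)
    also have "(\<Sum>(b, i)\<in>{..<k} \<times> {..<n}. f1 a j b (\<omega> (b, i))) =
        (\<Sum>b<k. if b = a then (\<Sum>i<n. \<omega> (a, i) j - \<gamma> a $ j) else 0)"
      unfolding sum.cartesian_product[symmetric] by (intro sum.cong refl) (auto simp: f1_def)
    also have "\<dots> = (\<Sum>i<n. \<omega> (a, i) j - \<gamma> a $ j)" using that by simp
    finally show ?thesis .
  qed
  have 2: "\<bar>(\<Sum>a<k. \<Sum>i<n. (\<omega> (a, i) j - \<gamma> a $ j) * (\<omega> (a, i) l - \<gamma> a $ l))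
         - real (k * n) * (\<sigma>\<^sup>2 * of_bool (j = l))\<bar> < real n * e"
    if "\<omega> \<in> E n" "j < m" "l < m" for \<omega> n j l
  proof -
    have "f2 j l \<in> F" using that unfolding F_def by force
    then have "\<bar>\<Sum>(b, i)\<in>{..<k} \<times> {..<n}. f2 j l b (\<omega> (b, i))\<bar> < real n * e"
      using that(1) by (auto simp: E_def)
    then show ?thesis
      unfolding sum.cartesian_product[symmetric] f2_def by (simp add: sum_subtractf mult.assoc)
  qed
  show ?thesis
    by (rule that[of E]) (fact wl 1 2)+
qed

section \<open>Assembly of the probabilistic and deterministic bounds\<close>

theorem theorem11:
  fixes c :: real
  assumes "c > 0"
  shows "\<exists>C>0. \<forall>(k::nat) (m::nat) (\<sigma>::real) (\<gamma> :: nat \<Rightarrow> real Matrix.vec).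
    k \<ge> 2 \<longrightarrow> m \<ge> 1 \<longrightarrow> \<sigma> > 0 \<longrightarrow>
    (\<forall>a<k. \<gamma> a \<in> carrier_vec m) \<longrightarrow> inj_on \<gamma> {..<k} \<longrightarrow>
    \<sigma> \<le> c * min_separation k \<gamma> / sqrt (real k) \<longrightarrow>
    with_high_probability (\<lambda>n. mixture_sample k n \<gamma> \<sigma>)
      (\<lambda>n \<omega>. let P = data_matrix m k n \<omega> in
        \<forall>X. sdp_minimizer k (sq_dist_matrix P) X \<longrightarrow>
          1 / real (k * n) *
            (\<Sum>a<k. \<Sum>i<n. (l2norm (col (P * X) (a * n + i) - centroid n P a))\<^sup>2)
          \<le> C * ((spectral_norm (centered_centroids k n P))\<^sup>2 / (min_separation k \<gamma>)\<^sup>2)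
              * (real k * \<sigma>\<^sup>2))"
proof (intro exI[of _ 448] conjI allI impI)
  fix k m :: nat and \<sigma> :: real and \<gamma> :: "nat \<Rightarrow> real Matrix.vec"
  assume k: "2 \<le> k" and m: "1 \<le> m" and \<sigma>: "0 < \<sigma>"
    and \<gamma>': "\<forall>a<k. \<gamma> a \<in> carrier_vec m" and inj: "inj_on \<gamma> {..<k}"
  from \<gamma>' have \<gamma>: "\<And>a. a < k \<Longrightarrow> \<gamma> a \<in> carrier_vec m" by blast
  define \<Delta> where "\<Delta> = min_separation k \<gamma>"
  note sep = min_separation[OF k \<gamma> inj, folded \<Delta>_def]
  \<comment> \<open>The first entry of the minimum keeps the empirical centroids separated, the
    second keeps the error of the second moment matrix below its mean
    \<open>k * n * \<sigma>\<^sup>2\<close>.\<close>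
  define e where "e = min (\<Delta> / (4 * real m)) (real k * \<sigma>\<^sup>2 / real m)"
  have e: "0 < e" using sep(1) k m \<sigma> by (simp add: e_def)
  have e1: "2 * real m * e \<le> \<Delta> / 2" and e2: "real m * e \<le> real k * \<sigma>\<^sup>2"
  proof -
    have "e \<le> \<Delta> / (4 * real m)" "e \<le> real k * \<sigma>\<^sup>2 / real m" by (auto simp: e_def)
    then show "2 * real m * e \<le> \<Delta> / 2" "real m * e \<le> real k * \<sigma>\<^sup>2"
      using m by (auto simp: field_simps)
  qed
  obtain E where E_sets: "\<And>n. E n \<in> sets (mixture_sample k n \<gamma> \<sigma>)"
    and E_lim: "(\<lambda>n. measure (mixture_sample k n \<gamma> \<sigma>) (E n)) \<longlonglongrightarrow> 1"
    and E1: "\<And>n \<omega> a j. \<omega> \<in> E n \<Longrightarrow> a < k \<Longrightarrow> j < m \<Longrightarrow> \<bar>\<Sum>i<n. \<omega> (a, i) j - \<gamma> a $ j\<bar> < real n * e"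
    and E2: "\<And>n \<omega> j l. \<omega> \<in> E n \<Longrightarrow> j < m \<Longrightarrow> l < m \<Longrightarrow>
      \<bar>(\<Sum>a<k. \<Sum>i<n. (\<omega> (a, i) j - \<gamma> a $ j) * (\<omega> (a, i) l - \<gamma> a $ l))
         - real (k * n) * (\<sigma>\<^sup>2 * of_bool (j = l))\<bar> < real n * e"
    by (rule mixture_concentration[where \<gamma> = \<gamma> and k = k and m = m, OF \<sigma> _ e]) (erule \<gamma>, rule that)
  show "with_high_probability (\<lambda>n. mixture_sample k n \<gamma> \<sigma>)
      (\<lambda>n \<omega>. let P = data_matrix m k n \<omega> in
        \<forall>X. sdp_minimizer k (sq_dist_matrix P) X \<longrightarrow>
          1 / real (k * n) *
            (\<Sum>a<k. \<Sum>i<n. (l2norm (col (P * X) (a * n + i) - centroid n P a))\<^sup>2)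
          \<le> 448 * ((spectral_norm (centered_centroids k n P))\<^sup>2 / (min_separation k \<gamma>)\<^sup>2)
              * (real k * \<sigma>\<^sup>2))"
    unfolding with_high_probability_def Let_def \<Delta>_def[symmetric]
  proof (intro exI[of _ E] conjI allI ballI impI E_sets E_lim)
    fix n \<omega> X
    assume \<omega>: "\<omega> \<in> E n" and min: "sdp_minimizer k (sq_dist_matrix (data_matrix m k n \<omega>)) X"
    define P where "P = data_matrix m k n \<omega>"
    define g where "g a i j = \<omega> (a, i) j - \<gamma> a $ j" for a i j
    have P: "P \<in> carrier_mat m (k * n)" by (simp add: P_def data_matrix_def)
    \<comment> \<open>The strict inequality defining the event fails for \<open>n = 0\<close>, where
      both sides are 0.\<close>
    have n: "n > 0"
    proof (rule gr0I)
      assume "n = 0"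
      then show False using E1[OF \<omega>, of 0 0] k m by simp
    qed
    have cent: "centroid n P a $ j = \<gamma> a $ j + (\<Sum>i<n. g a i j) / real n" if "a < k" "j < m" for a j
    proof -
      have "(\<Sum>i<n. P $$ (j, a * n + i)) = (\<Sum>i<n. \<omega> (a, i) j)"
        using that by (intro sum.cong refl) (simp add: P_def data_matrix_entry)
      then show ?thesis using that n P by (simp add: centroid_def g_def sum_subtractf field_simps)
    qed
    define B where "B = 2 * (real (k * n) * \<sigma>\<^sup>2)"
    have B: "(\<Sum>a<k. \<Sum>i<n. (\<Sum>j<m. (P $$ (j, a * n + i) - centroid n P a $ j) * v j)\<^sup>2)
        \<le> B * (\<Sum>j<m. (v j)\<^sup>2)" for v
    proof -
      \<comment> \<open>Moving from the true to the empirical center of a cluster subtracts the mean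
        of the projected noise, which can only decrease the sum of squares.\<close>
      have "(\<Sum>i<n. (\<Sum>j<m. (P $$ (j, a * n + i) - centroid n P a $ j) * v j)\<^sup>2)
          \<le> (\<Sum>i<n. (\<Sum>j<m. g a i j * v j)\<^sup>2)" if "a < k" for a
      proof -
        have "(\<Sum>j<m. (P $$ (j, a * n + i) - centroid n P a $ j) * v j) =
            (\<Sum>j<m. g a i j * v j) - (\<Sum>l<n. \<Sum>j<m. g a l j * v j) / real n" if i: "i < n" for i
        proof -
          have "(\<Sum>l<n. \<Sum>j<m. g a l j * v j) = (\<Sum>j<m. (\<Sum>l<n. g a l j) * v j)"
            by (subst sum.swap) (simp add: sum_distrib_right)
          moreover have "P $$ (j, a * n + i) - centroid n P a $ j = g a i j - (\<Sum>l<n. g a l j) / real n"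
            if "j < m" for j
            using cent[OF \<open>a < k\<close> that] that i \<open>a < k\<close> by (simp add: P_def data_matrix_entry g_def)
          ultimately show ?thesis
            by (simp add: sum_divide_distrib[of _ "{..<m}"] left_diff_distrib sum_subtractf)
        qed
        then show ?thesis
          using sum_centered_sq[OF n, of "\<lambda>i. \<Sum>j<m. g a i j * v j"] by simp
      qed
      then have "(\<Sum>a<k. \<Sum>i<n. (\<Sum>j<m. (P $$ (j, a * n + i) - centroid n P a $ j) * v j)\<^sup>2)
          \<le> (\<Sum>a<k. \<Sum>i<n. (\<Sum>j<m. g a i j * v j)\<^sup>2)"
        by (rule sum_mono) simp
      also have "\<dots> = (\<Sum>r\<in>{..<k} \<times> {..<n}. (\<Sum>j<m. g (fst r) (snd r) j * v j)\<^sup>2)"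
        by (simp add: sum.cartesian_product case_prod_beta)
      also have "\<dots> \<le> 2 * (real (k * n) * \<sigma>\<^sup>2) * (\<Sum>j<m. (v j)\<^sup>2)"
      proof (rule empirical_second_moment_bound)
        fix j l assume "j < m" "l < m"
        have "(\<Sum>r\<in>{..<k} \<times> {..<n}. g (fst r) (snd r) j * g (fst r) (snd r) l) =
            (\<Sum>a<k. \<Sum>i<n. g a i j * g a i l)"
          by (simp add: sum.cartesian_product case_prod_beta)
        then show "\<bar>(\<Sum>r\<in>{..<k} \<times> {..<n}. g (fst r) (snd r) j * g (fst r) (snd r) l)
            - real (k * n) * \<sigma>\<^sup>2 * of_bool (j = l)\<bar> \<le> real n * e"
          using E2[OF \<omega> \<open>j < m\<close> \<open>l < m\<close>] by (simp add: g_def mult.assoc)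
      next
        have "real m * (real n * e) = real n * (real m * e)" by simp
        also have "\<dots> \<le> real n * (real k * \<sigma>\<^sup>2)" using e2 by (intro mult_left_mono) auto
        finally show "real m * (real n * e) \<le> real (k * n) * \<sigma>\<^sup>2" by (simp add: mult_ac)
      qed
      finally show ?thesis by (simp add: B_def)
    qed
    have "(\<Sum>a<k. \<Sum>i<n. (l2norm (col (P * X) (a * n + i) - centroid n P a))\<^sup>2) \<le> 14 * real k * B"
      by (rule sdp_minimizer_error[OF n P min[folded P_def] _ B]) (simp add: B_def)
    \<comment> \<open>Dividing \<open>14 * k * B\<close> with
      \<open>B = 2 * k * n * \<sigma>\<^sup>2\<close> by \<open>k * n\<close> leaves the factor
      28.\<close>
    then have err: "1 / real (k * n) * (\<Sum>a<k. \<Sum>i<n. (l2norm (col (P * X) (a * n + i) - centroid n P a))\<^sup>2)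
        \<le> 28 * (real k * \<sigma>\<^sup>2)"
      using n k by (simp add: B_def field_simps)
    let ?S = "spectral_norm (centered_centroids k n P)"
    \<comment> \<open>Two clusters suffice: the centers 0 and 1 are at least \<open>\<Delta>\<close>
      apart, and replacing them by the empirical centroids costs at most
      \<open>\<Delta> / 2\<close>, so \<open>\<Delta> \<le> 2 * ?S + \<Delta> / 2\<close>.\<close>
    have "\<Delta> / 4 \<le> ?S"
    proof -
      have k01: "0 < k" "1 < k" using k by auto
      define d where "d a j = (\<Sum>i<n. g a i j) / real n" for a j
      have d: "\<bar>d a j\<bar> \<le> e" if "a < k" "j < m" for a j
        using E1[OF \<omega> that] n by (simp add: d_def g_def abs_divide field_simps)
      have dims: "dim_vec (\<gamma> 0) = m" "dim_vec (\<gamma> 1) = m" using \<gamma> k01 by auto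
      have "\<Delta> \<le> l2norm (\<gamma> 0 - \<gamma> 1)" using sep(2) k01 by simp
      also have "\<dots> = L2_set (\<lambda>j. (centroid n P 0 $ j - centroid n P 1 $ j) + (d 1 j - d 0 j)) {..<m}"
        unfolding l2norm_def using dims k01 by (intro L2_set_cong) (auto simp: cent d_def)
      also have "\<dots> \<le> L2_set (\<lambda>j. centroid n P 0 $ j - centroid n P 1 $ j) {..<m} + L2_set (\<lambda>j. d 1 j - d 0 j) {..<m}"
        by (rule L2_set_triangle_ineq)
      also have "L2_set (\<lambda>j. centroid n P 0 $ j - centroid n P 1 $ j) {..<m} = l2norm (centroid n P 0 - centroid n P 1)"
        unfolding l2norm_def using P by (intro L2_set_cong) (auto simp: centroid_def)
      also have "\<dots> \<le> 2 * ?S"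
        using k01 by (intro centroid_separation_le_spectral_norm[OF P]) auto
      also have "L2_set (\<lambda>j. d 1 j - d 0 j) {..<m} \<le> (\<Sum>j<m. \<bar>d 1 j - d 0 j\<bar>)"
        by (rule L2_set_le_sum_abs)
      also have "\<dots> \<le> (\<Sum>j<m. 2 * e)"
        using d[OF k01(1)] d[OF k01(2)] by (intro sum_mono) (smt (verit) lessThan_iff)
      also have "\<dots> \<le> \<Delta> / 2" using e1 by simp
      finally show ?thesis by simp
    qed
    then have "(\<Delta> / 4)\<^sup>2 \<le> ?S\<^sup>2" using sep(1) by (intro power_mono) auto
    then have ratio: "1 / 16 \<le> ?S\<^sup>2 / \<Delta>\<^sup>2" using sep(1) by (simp add: field_simps)
    \<comment> \<open>448 is 28 times 16, the latter from squaring the factor 4 in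
      \<open>\<Delta> / 4 \<le> ?S\<close>.\<close>
    have "28 * (real k * \<sigma>\<^sup>2) = 448 * (1 / 16) * (real k * \<sigma>\<^sup>2)" by simp
    also have "\<dots> \<le> 448 * (?S\<^sup>2 / \<Delta>\<^sup>2) * (real k * \<sigma>\<^sup>2)"
      by (intro mult_right_mono mult_left_mono ratio) auto
    finally show "1 / real (k * n) *
        (\<Sum>a<k. \<Sum>i<n. (l2norm (col (data_matrix m k n \<omega> * X) (a * n + i) - centroid n (data_matrix m k n \<omega>) a))\<^sup>2)
      \<le> 448 * ((spectral_norm (centered_centroids k n (data_matrix m k n \<omega>)))\<^sup>2 / \<Delta>\<^sup>2) * (real k * \<sigma>\<^sup>2)"
      using err unfolding P_def by linarith
  qed
qed simp

end
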